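(* Let $f:\mathbb{R}_{++}\to\mathbb{R}$ be a differentiable function such that $s\mapsto s f'(s)$ is monotonically increasing on $\mathbb{R}_{++}$. Then, for any positive definite matrices $A,B\in\mathbb{R}^{n\times n}$, $$\sum_{i=1}^n f\big(\lambda_i(A)\lambda_{n-i+1}(B)\big)\le \sum_{i=1}^n f\big(\lambda_i(B^{1/2}AB^{1/2})\big)\le \sum_{i=1}^n f\big(\lambda_i(A)\lambda_i(B)\big).$$ If $f$ is additionally defined and right-continuous at $0$, then the same inequalities hold for any positive semidefinite matrices $A,B\in\mathbb{R}^{n\times n}$.
   Context: $\mathbb{R}_{++}$ denotes the set of positive real numbers. Positive (semi)definite matrices are real symmetric. For a real symmetric $n\times n$ matrix $X$, $\lambda_i(X)$ denotes its $i$-th largest eigenvalue (counted with multiplicity), so $\lambda_1(X)\ge\cdots\ge\lambda_n(X)$. $B^{1/2}$ denotes the positive semidefinite square root of $B$. "Monotonically increasing" means nondecreasing (not necessarily strictly increasing). *)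

theory Defs
  imports Complex_Main "Jordan_Normal_Form.Char_Poly"
begin

(* A\<^sup>T = A forces A to be square. *)

definition pos_def :: "real mat \<Rightarrow> bool" where
  "pos_def A \<longleftrightarrow> transpose_mat A = A \<and>
     (\<forall>v \<in> carrier_vec (dim_row A). v \<noteq> 0\<^sub>v (dim_row A) \<longrightarrow> v \<bullet> (A *\<^sub>v v) > 0)"

definition pos_semidef :: "real mat \<Rightarrow> bool" where
  "pos_semidef A \<longleftrightarrow> transpose_mat A = A \<and>
     (\<forall>v \<in> carrier_vec (dim_row A). v \<bullet> (A *\<^sub>v v) \<ge> 0)"

(* Meaningful only for positive semidefinite B, where C exists and is unique. *)
definition psd_sqrt :: "real mat \<Rightarrow> real mat" where
  "psd_sqrt B = (THE C. pos_semidef C \<and> C * C = B)"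

(* The i-th largest eigenvalue, 1-based: the multiset proots records each root of the
   characteristic polynomial with its order. A real symmetric n x n matrix has n real
   roots, so this is meaningful for 1 \<le> i \<le> n. *)
definition eigval :: "nat \<Rightarrow> real mat \<Rightarrow> real" where
  "eigval i A = rev (sorted_list_of_multiset (proots (char_poly A))) ! (i - 1)"

end

theory Submission
  imports Defs "Jordan_Normal_Form.Schur_Decomposition"
begin

text \<open>
  The hypothesis says that \<open>f \<circ> exp\<close> is convex, so both inequalities follow from Karamata's
  inequality once the eigenvalues of \<open>C = B\<^sup>1\<^sup>/\<^sup>2AB\<^sup>1\<^sup>/\<^sup>2\<close> are shown to be log-majorized by
  \<open>\<lambda>\<^sub>i(A)\<lambda>\<^sub>i(B)\<close> and to log-majorize \<open>\<lambda>\<^sub>i(A)\<lambda>\<^sub>n\<^sub>-\<^sub>i\<^sub>+\<^sub>1(B)\<close>. Both are instances of the multiplicative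
  Lidskii inequality
  \<open>\<Prod>\<^sub>i\<^sub>\<in>\<^sub>I \<lambda>\<^sub>i(S\<^sup>TAS) \<le> \<Prod>\<^sub>i\<^sub>\<in>\<^sub>I \<lambda>\<^sub>i(S\<^sup>TS) \<cdot> \<Prod>\<^sub>i\<^sub>\<le>\<^sub>|\<^sub>I\<^sub>| \<lambda>\<^sub>i(A)\<close>: the first with \<open>S = B\<^sup>1\<^sup>/\<^sup>2\<close>, the second with
  \<open>S = B\<^sup>-\<^sup>1\<^sup>/\<^sup>2\<close> and \<open>C\<close> in place of \<open>A\<close>. The semidefinite case is the limit \<open>\<epsilon> \<rightarrow> 0\<close> of the
  definite one for \<open>A + \<epsilon>I\<close> and \<open>(B\<^sup>1\<^sup>/\<^sup>2 + \<epsilon>I)\<^sup>2\<close>, by continuity of eigenvalues.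
\<close>

section \<open>Spectral theorem for real symmetric matrices\<close>

text \<open>For an eigenvector \<open>v\<close>, moving the real symmetric matrix across the
  Hermitian form gives \<open>z * (v \<bullet>c v) = cnj z * (v \<bullet>c v)\<close>, and
  \<open>v \<bullet>c v\<close> is nonzero.\<close>

lemma real_sym_eigenvalue_real:
  fixes A :: "real mat"
  assumes A: "A \<in> carrier_mat n n" and sym: "transpose_mat A = A"
    and ev: "eigenvalue (map_mat complex_of_real A) z"
  shows "z \<in> \<real>"
proof -
  let ?A = "map_mat complex_of_real A"
  have cA: "?A \<in> carrier_mat n n" using A by simp
  have symc: "transpose_mat ?A = ?A"
    using sym by (simp add: map_mat_transpose)
  obtain v where v: "v \<in> carrier_vec n" "v \<noteq> 0\<^sub>v n" "?A *\<^sub>v v = z \<cdot>\<^sub>v v"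
    using ev A unfolding eigenvalue_def eigenvector_def by auto
  have "conjugate (?A *\<^sub>v v) = ?A *\<^sub>v conjugate v"
    using A v(1) by (intro eq_vecI) (auto simp: scalar_prod_def sum_conjugate conjugate_dist_mul)
  then have c: "?A *\<^sub>v conjugate v = conjugate z \<cdot>\<^sub>v conjugate v"
    using v(3) by (simp add: conjugate_smult_vec)
  have "z * (v \<bullet>c v) = (?A *\<^sub>v v) \<bullet>c v" using v by simp
  also have "\<dots> = v \<bullet> (?A *\<^sub>v conjugate v)"
    using transpose_vec_mult_scalar[OF cA _ v(1), of "conjugate v"] symc v(1) by simp
  also have "\<dots> = cnj z * (v \<bullet>c v)" using c v by simp
  finally show ?thesis
    using v by (simp add: Reals_cnj_iff)
qed

text \<open>The polynomial splits over the complex numbers with all roots real; injectivity of the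
  coefficient embedding pulls the factorization back to the reals.\<close>

lemma real_sym_char_poly_splits:
  fixes A :: "real mat"
  assumes A: "A \<in> carrier_mat n n" and sym: "transpose_mat A = A"
  shows "\<exists>es. char_poly A = (\<Prod>e\<leftarrow>es. [:- e, 1:])"
proof -
  let ?A = "map_mat complex_of_real A"
  have cA: "?A \<in> carrier_mat n n" using A by simp
  obtain as where as: "char_poly ?A = (\<Prod>a\<leftarrow>as. [:- a, 1:])"
    using char_poly_factorized[OF cA] by blast
  have "a \<in> \<real>" if "a \<in> set as" for a
  proof (rule real_sym_eigenvalue_real[OF A sym])
    have "poly (char_poly ?A) a = 0"
      using that unfolding as by (induction as) auto
    then show "eigenvalue ?A a" using eigenvalue_root_char_poly[OF cA] by simp
  qed
  then have "complex_of_real (Re a) = a" if "a \<in> set as" for a using that by simp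
  then have "as = map complex_of_real (map Re as)" by (simp add: map_idI)
  moreover interpret mp: map_poly_inj_comm_ring_hom complex_of_real ..
  have "map_poly complex_of_real (\<Prod>e\<leftarrow>rs. [:- e, 1:])
      = (\<Prod>e\<leftarrow>map complex_of_real rs. [:- e, 1:])" for rs
    by (induction rs) (simp_all add: mp.hom_mult del: mult_pCons_left)
  ultimately have "map_poly complex_of_real (char_poly A)
      = map_poly complex_of_real (\<Prod>e\<leftarrow>map Re as. [:- e, 1:])"
    using as by (metis of_real_hom.char_poly_hom[OF A])
  then show ?thesis by (metis mp.eq_iff)
qed

lemma orthonormal_completion:
  fixes v :: "real vec"
  assumes v: "v \<in> carrier_vec n" "v \<noteq> 0\<^sub>v n"
  shows "\<exists>W \<in> carrier_mat n n. \<exists>c. transpose_mat W * W = 1\<^sub>m n \<and> col W 0 = c \<cdot>\<^sub>v v"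
proof -
  interpret cof_vec_space n "TYPE(real)" .
  define b where "b = basis_completion v"
  define ws where "ws = gram_schmidt n b"
  from basis_completion[OF v, folded b_def]
  have dist_b: "distinct b" and indep: "\<not> lin_dep (set b)" and b: "set b \<subseteq> carrier_vec n"
    and hdb: "hd b = v" and len_b: "length b = n" by auto
  have n: "n > 0" using v by (cases n) auto
  from hdb len_b n obtain vs where bv: "b = v # vs" by (cases b, auto)
  from gram_schmidt_result[OF b dist_b indep refl, folded ws_def]
  have ws: "set ws \<subseteq> carrier_vec n" "corthogonal ws" "length ws = n" by (auto simp: len_b)
  have hdws: "hd ws = v" using gram_schmidt_hd[OF v(1), of vs, folded bv] by (simp add: ws_def)
  have w: "ws ! i \<in> carrier_vec n" if "i < n" for i using ws that by (metis nth_mem subsetD)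
  have orth: "(ws ! i \<bullet> ws ! j = 0) = (i \<noteq> j)" if "i < n" "j < n" for i j
    using corthogonalD[OF ws(2), of i j] that ws(3) by (simp add: vec_conjugate_real)
  \<comment> \<open>Gram-Schmidt yields orthogonal but unnormalized vectors. Their squared lengths
    are positive, so they can be rescaled, and the first one remains a multiple of
    \<open>v\<close>.\<close>
  have pos: "ws ! i \<bullet> ws ! i > 0" if "i < n" for i
    using orth[OF that that] conjugate_square_ge_0_vec[of "ws ! i"] by simp
  define c where "c i = 1 / sqrt (ws ! i \<bullet> ws ! i)" for i
  define W where "W = mat_of_cols n (map (\<lambda>i. c i \<cdot>\<^sub>v ws ! i) [0..<n])"
  have W: "W \<in> carrier_mat n n" unfolding W_def by (simp add: carrier_matI)
  have col: "col W i = c i \<cdot>\<^sub>v ws ! i" if "i < n" for i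
    unfolding W_def using that w by (subst col_mat_of_cols) auto
  have "transpose_mat W * W = 1\<^sub>m n"
  proof (rule eq_matI)
    fix i j assume ij: "i < dim_row (1\<^sub>m n)" "j < dim_col (1\<^sub>m n)"
    then have "(transpose_mat W * W) $$ (i, j) = c i * (c j * (ws ! i \<bullet> ws ! j))"
      using W w[of i] w[of j] by (simp add: col)
    also have "\<dots> = 1\<^sub>m n $$ (i, j)"
      using ij orth[of i j] pos[of i] by (auto simp: c_def)
    finally show "(transpose_mat W * W) $$ (i, j) = 1\<^sub>m n $$ (i, j)" .
  qed (use W in auto)
  moreover have "col W 0 = c 0 \<cdot>\<^sub>v v" using col[OF n] hdws n ws(3) by (metis hd_conv_nth length_greater_0_conv)
  ultimately show ?thesis using W by blast
qed

text \<open>Deflation, by induction on the list of roots: an eigenvector for the head is split off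
  and the remaining block has the tail as its roots. The order of \<open>es\<close> is kept on the
  diagonal, so a later caller can choose it sorted.\<close>

lemma real_sym_diagonalize:
  fixes A :: "real mat"
  assumes "A \<in> carrier_mat n n" "transpose_mat A = A" "char_poly A = (\<Prod>e\<leftarrow>es. [:- e, 1:])"
  shows "\<exists>U \<in> carrier_mat n n. transpose_mat U * U = 1\<^sub>m n \<and>
    A = U * mat_diag n (\<lambda>i. es ! i) * transpose_mat U"
  using assms
proof (induction es arbitrary: n A)
  case Nil
  then have "n = 0" using degree_monic_char_poly[of A n] by simp
  then show ?case using Nil by (intro bexI[of _ "1\<^sub>m n"]) auto
next
  case (Cons e es)
  note A = Cons.prems(1) and sym = Cons.prems(2) and cp = Cons.prems(3)
  have "n \<noteq> 0"
    using degree_linear_factors[of uminus "e # es"] degree_monic_char_poly[OF A] cp by simp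
  then obtain m where n: "n = Suc m" by (cases n) auto
  have "eigenvalue A e" using cp eigenvalue_root_char_poly[OF A] by simp
  then obtain v where v: "v \<in> carrier_vec n" "v \<noteq> 0\<^sub>v n" "A *\<^sub>v v = e \<cdot>\<^sub>v v"
    using A unfolding eigenvalue_def eigenvector_def by auto
  obtain W c where W: "W \<in> carrier_mat n n" and orthW: "transpose_mat W * W = 1\<^sub>m n"
    and col0: "col W 0 = c \<cdot>\<^sub>v v"
    using orthonormal_completion[OF v(1,2)] by blast
  have Wt: "transpose_mat W \<in> carrier_mat n n" using W by simp
  have orthW': "W * transpose_mat W = 1\<^sub>m n"
    using mat_mult_left_right_inverse[OF Wt W orthW] .
  note assoc = assoc_mult_mat[of _ n n _ n _ n]
  define A' where "A' = transpose_mat W * A * W"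
  have A': "A' \<in> carrier_mat n n" using A W unfolding A'_def by simp
  have symA': "transpose_mat A' = A'"
    unfolding A'_def using A W Wt sym by (simp add: transpose_mult[of _ n n _ n] assoc)
  have "col (A * W) 0 = A *\<^sub>v col W 0" by (rule col_mult2[OF A W]) (simp add: n)
  also have "\<dots> = e \<cdot>\<^sub>v col W 0" using A v by (simp add: col0 mult_mat_vec[of _ n n] smult_smult_assoc mult.commute)
  finally have colAW: "col (A * W) 0 = e \<cdot>\<^sub>v col W 0" .
  \<comment> \<open>The first column of \<open>W\<close> is an eigenvector orthogonal to the other
    columns, so the first column of \<open>A'\<close> is \<open>e\<close> followed by zeros.
    Symmetry transfers this to the first row.\<close>
  have A'0: "A' $$ (i, 0) = (if i = 0 then e else 0)" if i: "i < n" for i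
  proof -
    have "A' $$ (i, 0) = (transpose_mat W * (A * W)) $$ (i, 0)"
      unfolding A'_def using A W Wt by (simp add: assoc)
    also have "\<dots> = col W i \<bullet> col (A * W) 0" using i A W n by simp
    also have "\<dots> = e * (transpose_mat W * W) $$ (i, 0)"
      unfolding colAW using i W n by simp
    finally show ?thesis using i n by (simp add: orthW)
  qed
  have A'0': "A' $$ (0, i) = (if i = 0 then e else 0)" if i: "i < n" for i
    using A'0[OF i] symA' A' i n by (metis carrier_matD index_transpose_mat(1) zero_less_Suc)
  define A3 where "A3 = mat m m (\<lambda>(i,j). A' $$ (Suc i, Suc j))"
  define E where "E = mat 1 1 (\<lambda>_. e)"
  have A3: "A3 \<in> carrier_mat m m" and E: "E \<in> carrier_mat 1 1" unfolding A3_def E_def by auto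
  have block: "A' = four_block_mat E (0\<^sub>m 1 m) (0\<^sub>m m 1) A3"
    using A' n by (intro eq_matI) (auto simp: E_def A3_def A'0 A'0')
  have symA3: "transpose_mat A3 = A3"
  proof (rule eq_matI)
    fix i j assume "i < dim_row A3" "j < dim_col A3"
    then have ij: "Suc i < n" "Suc j < n" using A3 n by auto
    have "A' $$ (Suc j, Suc i) = A' $$ (Suc i, Suc j)"
      using symA' A' ij by (metis carrier_matD index_transpose_mat(1))
    then show "transpose_mat A3 $$ (i, j) = A3 $$ (i, j)" using ij n by (simp add: A3_def)
  qed (use A3 in auto)
  have "similar_mat A' A"
    unfolding similar_mat_def
    by (rule exI[of _ "transpose_mat W"], rule exI[of _ W], rule similar_mat_witI[of _ _ n])
      (use A A' W Wt orthW orthW' in \<open>auto simp: A'_def\<close>)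
  then have "char_poly A' = char_poly A" by (rule char_poly_similar)
  moreover have "char_poly A' = char_poly E * char_poly A3"
    unfolding block using char_poly_four_block_zeros_col[OF E _ A3] by simp
  moreover have "char_poly E = [:- e, 1:]"
    by (simp add: E_def char_poly_defs det_def sign_def)
  \<comment> \<open>Cancelling the nonzero factor for \<open>e\<close> leaves exactly the
    factorization that the induction hypothesis requires of \<open>A3\<close>.\<close>
  ultimately have "[:- e, 1:] * char_poly A3 = [:- e, 1:] * (\<Prod>e\<leftarrow>es. [:- e, 1:])"
    using cp by simp
  then have "char_poly A3 = (\<Prod>e\<leftarrow>es. [:- e, 1:])"
    by (metis mult_cancel_left pCons_eq_0_iff zero_neq_one)
  from Cons.IH[OF A3 symA3 this] obtain U where U: "U \<in> carrier_mat m m"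
    and orthU: "transpose_mat U * U = 1\<^sub>m m"
    and A3_eq: "A3 = U * mat_diag m (\<lambda>i. es ! i) * transpose_mat U" by blast
  have Ut: "transpose_mat U \<in> carrier_mat m m" using U by simp
  \<comment> \<open>The diagonalizer of the smaller block, extended by a trivial 1 x 1 block; the
    orthogonal matrix for \<open>A\<close> is then \<open>W * V\<close>.\<close>
  define V where "V = four_block_mat (1\<^sub>m 1) (0\<^sub>m 1 m) (0\<^sub>m m 1) U"
  define D where "D = mat_diag n (\<lambda>i. (e # es) ! i)"
  have V: "V \<in> carrier_mat n n" and D: "D \<in> carrier_mat n n"
    using U n unfolding V_def D_def by auto
  have Vt_eq: "transpose_mat V = four_block_mat (1\<^sub>m 1) (0\<^sub>m 1 m) (0\<^sub>m m 1) (transpose_mat U)"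
    unfolding V_def using U by (subst transpose_four_block_mat) auto
  have Vt: "transpose_mat V \<in> carrier_mat n n" using V by simp
  have D_eq: "D = four_block_mat E (0\<^sub>m 1 m) (0\<^sub>m m 1) (mat_diag m (\<lambda>i. es ! i))"
    unfolding D_def E_def mat_diag_def using n by (intro eq_matI) (auto simp: nth_Cons')
  have orthV: "transpose_mat V * V = 1\<^sub>m n"
    unfolding Vt_eq unfolding V_def
    by (subst mult_four_block_mat[of _ 1 1 _ m _ m _ _ 1 _ m])
      (use U Ut orthU n in auto)
  have "V * D * transpose_mat V = A'"
  proof -
    have "V * D = four_block_mat E (0\<^sub>m 1 m) (0\<^sub>m m 1) (U * mat_diag m (\<lambda>i. es ! i))"
      unfolding D_eq unfolding V_def
      by (subst mult_four_block_mat[of _ 1 1 _ m _ m _ _ 1 _ m])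
        (use U E in \<open>auto simp: left_mult_zero_mat[OF mat_diag_dim]\<close>)
    moreover have UD: "U * mat_diag m (\<lambda>i. es ! i) \<in> carrier_mat m m" using U by simp
    moreover note left_add_zero_mat[OF mult_carrier_mat[OF UD Ut]] right_mult_zero_mat[OF UD, of 1]
    ultimately show ?thesis
      unfolding Vt_eq block A3_eq
      by (simp, subst mult_four_block_mat[of _ 1 1 _ m _ m _ _ 1 _ m])
        (use U Ut E in auto)
  qed
  moreover have "(W * V) * D * transpose_mat (W * V) = W * (V * D * transpose_mat V) * transpose_mat W"
    using W V D Wt Vt by (simp add: transpose_mult[of _ n n _ n] assoc)
  ultimately have "(W * V) * D * transpose_mat (W * V) = W * A' * transpose_mat W" by simp
  also have "\<dots> = (W * transpose_mat W) * A * (W * transpose_mat W)"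
    unfolding A'_def using W A Wt by (simp add: assoc)
  also have "\<dots> = A" unfolding orthW' using A by simp
  finally have "A = (W * V) * D * transpose_mat (W * V)" ..
  moreover have "transpose_mat (W * V) * (W * V) = transpose_mat V * (transpose_mat W * W) * V"
    using W V Wt Vt by (simp add: transpose_mult[of _ n n _ n] assoc)
  then have "transpose_mat (W * V) * (W * V) = 1\<^sub>m n" using V Vt by (simp add: orthW orthV)
  ultimately show ?case
    using W V unfolding D_def by (intro bexI[of _ "W * V"]) auto
qed

section \<open>Reading eigenvalues off an orthogonal diagonalization\<close>

lemma char_poly_orth_diag:
  fixes U :: "real mat"
  assumes U: "U \<in> carrier_mat n n" and orth: "transpose_mat U * U = 1\<^sub>m n"
  shows "char_poly (U * mat_diag n d * transpose_mat U) = (\<Prod>i\<leftarrow>[0..<n]. [:- d i, 1:])"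
proof -
  have Ut: "transpose_mat U \<in> carrier_mat n n" using U by simp
  have orth': "U * transpose_mat U = 1\<^sub>m n"
    using mat_mult_left_right_inverse[OF Ut U orth] .
  have "similar_mat (U * mat_diag n d * transpose_mat U) (mat_diag n d)"
    unfolding similar_mat_def
    by (rule exI[of _ U], rule exI[of _ "transpose_mat U"], rule similar_mat_witI[of _ _ n])
      (use U Ut orth orth' in auto)
  then have "char_poly (U * mat_diag n d * transpose_mat U) = char_poly (mat_diag n d)"
    by (rule char_poly_similar)
  also have "\<dots> = (\<Prod>a\<leftarrow>diag_mat (mat_diag n d). [:- a, 1:])"
    by (rule char_poly_upper_triangular[of _ n]) (auto simp: mat_diag_def)
  also have "diag_mat (mat_diag n d) = map d [0..<n]"
    unfolding diag_mat_def mat_diag_def by (auto simp del: upt_Suc)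
  finally show ?thesis by (simp add: o_def)
qed

lemma proots_linear_factors:
  "proots (\<Prod>e\<leftarrow>es. [:- e, 1:]) = mset (es :: 'a :: idom list)"
proof (induction es)
  case (Cons e es)
  have "(\<Prod>e\<leftarrow>es. [:- e, 1:]) \<noteq> 0" by (auto simp: prod_list_zero_iff)
  then show ?case using Cons by (simp add: proots_mult del: mult_pCons_left)
qed simp

lemma eigval_orth_diag:
  fixes U :: "real mat"
  assumes U: "U \<in> carrier_mat n n" and orth: "transpose_mat U * U = 1\<^sub>m n"
    and anti: "\<And>i j. i \<le> j \<Longrightarrow> j < n \<Longrightarrow> d j \<le> d i" and i: "i < n"
  shows "eigval (Suc i) (U * mat_diag n d * transpose_mat U) = d i"
proof -
  let ?l = "map d [0..<n]"
  have "char_poly (U * mat_diag n d * transpose_mat U) = (\<Prod>e\<leftarrow>?l. [:- e, 1:])"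
    using char_poly_orth_diag[OF U orth] by (simp add: o_def)
  moreover have "sorted (rev ?l)"
    unfolding sorted_rev_iff_nth_mono using anti by simp
  ultimately have "sorted_list_of_multiset (proots (char_poly (U * mat_diag n d * transpose_mat U))) = rev ?l"
    by (metis proots_linear_factors mset_rev sorted_list_of_multiset_mset sorted_sort_id)
  then show ?thesis unfolding eigval_def using i by simp
qed

text \<open>Intended for the inverse of a matrix: inverting the eigenvalues reverses their order
  while the eigenbasis stays the same.\<close>

lemma eigval_orth_diag_rev:
  fixes U :: "real mat"
  assumes U: "U \<in> carrier_mat n n" and orth: "transpose_mat U * U = 1\<^sub>m n"
    and mono: "\<And>i j. i \<le> j \<Longrightarrow> j < n \<Longrightarrow> d i \<le> d j" and i: "i < n"
  shows "eigval (Suc i) (U * mat_diag n d * transpose_mat U) = d (n - Suc i)"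
proof -
  let ?l = "map d [0..<n]"
  have "char_poly (U * mat_diag n d * transpose_mat U) = (\<Prod>e\<leftarrow>?l. [:- e, 1:])"
    using char_poly_orth_diag[OF U orth] by (simp add: o_def)
  moreover have "sorted ?l"
    unfolding sorted_iff_nth_mono using mono by simp
  ultimately have "sorted_list_of_multiset (proots (char_poly (U * mat_diag n d * transpose_mat U))) = ?l"
    by (metis proots_linear_factors sorted_list_of_multiset_mset sorted_sort_id)
  then show ?thesis unfolding eigval_def using i by (simp add: rev_nth)
qed

lemma real_sym_eigval_list:
  fixes A :: "real mat"
  assumes A: "A \<in> carrier_mat n n" and sym: "transpose_mat A = A"
  shows "\<exists>ds U. U \<in> carrier_mat n n \<and> transpose_mat U * U = 1\<^sub>m n \<and>
    A = U * mat_diag n (\<lambda>i. ds ! i) * transpose_mat U \<and>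
    (\<forall>i j. i \<le> j \<longrightarrow> j < n \<longrightarrow> ds ! j \<le> ds ! i) \<and> (\<forall>i<n. eigval (Suc i) A = ds ! i)"
proof -
  obtain es where es: "char_poly A = (\<Prod>e\<leftarrow>es. [:- e, 1:])"
    using real_sym_char_poly_splits[OF A sym] by blast
  \<comment> \<open>The roots are sorted before diagonalizing, so the diagonal already agrees with
    the order used by \<open>eigval\<close>.\<close>
  define ds where "ds = rev (sort es)"
  have "mset (map (\<lambda>e. [:- e, 1:]) ds) = mset (map (\<lambda>e. [:- e, 1:]) es)"
    unfolding ds_def by simp
  then have ds: "char_poly A = (\<Prod>e\<leftarrow>ds. [:- e, 1:])"
    unfolding es by (metis prod_mset_prod_list)
  have len: "length ds = n"
    using degree_linear_factors[of uminus ds] degree_monic_char_poly[OF A] ds by simp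
  have anti: "ds ! j \<le> ds ! i" if "i \<le> j" "j < n" for i j
    using that len sorted_rev_iff_nth_mono[of ds] unfolding ds_def by simp
  obtain U where U: "U \<in> carrier_mat n n" "transpose_mat U * U = 1\<^sub>m n"
    and A_eq: "A = U * mat_diag n (\<lambda>i. ds ! i) * transpose_mat U"
    using real_sym_diagonalize[OF A sym ds] by blast
  have "eigval (Suc i) A = ds ! i" if "i < n" for i
    unfolding A_eq by (rule eigval_orth_diag[OF U anti that])
  with U A_eq anti show ?thesis by blast
qed

lemma eigval_antimono:
  assumes "A \<in> carrier_mat n n" "transpose_mat A = A" "i \<le> j" "j < n"
  shows "eigval (Suc j) A \<le> eigval (Suc i) A"
  using real_sym_eigval_list[OF assms(1,2)] assms(3,4) by auto

lemma eigval_diagonalize: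
  fixes A :: "real mat"
  assumes "A \<in> carrier_mat n n" "transpose_mat A = A"
  shows "\<exists>U \<in> carrier_mat n n. transpose_mat U * U = 1\<^sub>m n \<and>
    A = U * mat_diag n (\<lambda>i. eigval (Suc i) A) * transpose_mat U"
proof -
  obtain ds U where U: "U \<in> carrier_mat n n" "transpose_mat U * U = 1\<^sub>m n"
    "A = U * mat_diag n (\<lambda>i. ds ! i) * transpose_mat U"
    and ev: "\<And>i. i < n \<Longrightarrow> eigval (Suc i) A = ds ! i"
    using real_sym_eigval_list[OF assms] by blast
  have "mat_diag n (\<lambda>i. ds ! i) = mat_diag n (\<lambda>i. eigval (Suc i) A)"
    unfolding mat_diag_def by (rule eq_matI) (auto simp: ev)
  then show ?thesis using U by (intro bexI[of _ U]) simp_all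
qed

text \<open>In the eigenbasis coordinates \<open>transpose_mat U *\<^sub>v v\<close> the form is a
  weighted sum of squares, so comparisons of forms become comparisons of weights.\<close>

lemma quad_form_orth_diag:
  fixes U :: "real mat"
  assumes U: "U \<in> carrier_mat n n" and v: "v \<in> carrier_vec n"
  shows "v \<bullet> ((U * mat_diag n d * transpose_mat U) *\<^sub>v v) =
    (\<Sum>i<n. d i * ((transpose_mat U *\<^sub>v v) $ i)\<^sup>2)"
proof -
  let ?w = "transpose_mat U *\<^sub>v v"
  have Ut: "transpose_mat U \<in> carrier_mat n n" using U by simp
  have w: "?w \<in> carrier_vec n" using Ut v by simp
  have D: "mat_diag n d \<in> carrier_mat n n" by simp
  have "(U * mat_diag n d * transpose_mat U) *\<^sub>v v = U *\<^sub>v (mat_diag n d *\<^sub>v ?w)"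
    using U Ut D v w by (simp add: assoc_mult_mat_vec[of _ n n _ n])
  also have "v \<bullet> \<dots> = ?w \<bullet> (mat_diag n d *\<^sub>v ?w)"
    using transpose_vec_mult_scalar[OF U _ v, of "mat_diag n d *\<^sub>v ?w"] w
      mult_mat_vec_carrier[OF D w] by simp
  also have "\<dots> = (\<Sum>i<n. d i * (?w $ i)\<^sup>2)"
  proof -
    have "(mat_diag n d *\<^sub>v ?w) $ i = d i * ?w $ i" if "i < n" for i
    proof -
      have "(mat_diag n d *\<^sub>v ?w) $ i = (\<Sum>j\<in>{0..<n}. (if i = j then d j else 0) * ?w $ j)"
        using that w U by (simp add: mat_diag_def scalar_prod_def del: index_mult_mat_vec(1))
          (simp add: mult_mat_vec_def scalar_prod_def)
      also have "\<dots> = (\<Sum>j\<in>{0..<n}. if i = j then d j * ?w $ j else 0)"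
        by (rule sum.cong) auto
      also have "\<dots> = d i * ?w $ i" using that by (simp add: sum.delta)
      finally show ?thesis .
    qed
    moreover have "dim_vec (mat_diag n d *\<^sub>v ?w) = n" by (simp add: mat_diag_def)
    ultimately show ?thesis unfolding scalar_prod_def
      by (intro sum.cong) (auto simp: power2_eq_square simp del: index_mult_mat_vec)
  qed
  finally show ?thesis .
qed

section \<open>Monotonicity and continuity of eigenvalues\<close>

lemma scalar_prod_self_sum:
  fixes v :: "real vec"
  assumes "v \<in> carrier_vec n"
  shows "v \<bullet> v = (\<Sum>i<n. (v $ i)\<^sup>2)"
  using assms by (auto simp: scalar_prod_def power2_eq_square intro!: sum.cong)

lemma scalar_prod_self_pos:
  fixes v :: "real vec"
  assumes "v \<in> carrier_vec n" "v \<noteq> 0\<^sub>v n"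
  shows "v \<bullet> v > 0"
  using conjugate_square_greater_0_vec[OF assms(1)] assms(2) by simp

lemma norm_orth:
  fixes U :: "real mat"
  assumes U: "U \<in> carrier_mat n n" and orth: "transpose_mat U * U = 1\<^sub>m n"
    and v: "v \<in> carrier_vec n"
  shows "(\<Sum>i<n. ((transpose_mat U *\<^sub>v v) $ i)\<^sup>2) = v \<bullet> v"
proof -
  have Ut: "transpose_mat U \<in> carrier_mat n n" using U by simp
  have "U * mat_diag n (\<lambda>_. 1) * transpose_mat U = 1\<^sub>m n"
    using mat_mult_left_right_inverse[OF Ut U orth] U by simp
  then show ?thesis using quad_form_orth_diag[OF U v, of "\<lambda>_. 1"] v by simp
qed

text \<open>Courant-Fischer by a dimension count: the span of the top \<open>k + 1\<close>
  eigenvectors of \<open>X\<close> meets the orthogonal complement of the top \<open>k\<close>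
  eigenvectors of \<open>Y\<close>, and a common vector compares the two forms. The factor
  \<open>t\<close> and the shift \<open>\<delta>\<close>, which may be negative, let one statement
  serve order comparison, scaling and perturbation.\<close>

lemma eigval_mono:
  fixes X Y :: "real mat"
  assumes X: "X \<in> carrier_mat n n" "transpose_mat X = X"
    and Y: "Y \<in> carrier_mat n n" "transpose_mat Y = Y"
    and t: "0 \<le> t" and k: "k < n"
    and le: "\<And>v. v \<in> carrier_vec n \<Longrightarrow> t * (v \<bullet> (X *\<^sub>v v)) + \<delta> * (v \<bullet> v) \<le> v \<bullet> (Y *\<^sub>v v)"
  shows "t * eigval (Suc k) X + \<delta> \<le> eigval (Suc k) Y"
proof -
  let ?a = "\<lambda>i. eigval (Suc i) X" and ?b = "\<lambda>i. eigval (Suc i) Y"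
  obtain P where P: "P \<in> carrier_mat n n" "transpose_mat P * P = 1\<^sub>m n"
    and X_eq: "X = P * mat_diag n ?a * transpose_mat P"
    using eigval_diagonalize[OF X] by blast
  note a = eigval_antimono[OF X]
  obtain Q where Q: "Q \<in> carrier_mat n n" "transpose_mat Q * Q = 1\<^sub>m n"
    and Y_eq: "Y = Q * mat_diag n ?b * transpose_mat Q"
    using eigval_diagonalize[OF Y] by blast
  note b = eigval_antimono[OF Y]
  have Pt: "transpose_mat P \<in> carrier_mat n n" and Qt: "transpose_mat Q \<in> carrier_mat n n"
    using P Q by auto
  define W where "W = transpose_mat Q * P"
  have W: "W \<in> carrier_mat n n" unfolding W_def using P Q by simp
  \<comment> \<open>A kernel vector of \<open>M\<close> gives a vector in the span of the first \<open>k + 1\<close> eigenvectors of \<open>X\<close>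
    that is orthogonal to the first \<open>k\<close> eigenvectors of \<open>Y\<close>.\<close>
  define M where "M = mat n n (\<lambda>(r, c). if r < k then W $$ (r, c) else if r = k then 0
    else if r = c then 1 else 0)"
  have M: "M \<in> carrier_mat n n" unfolding M_def by simp
  \<comment> \<open>Row \<open>k\<close> of \<open>M\<close> is zero, so \<open>M\<close> is
    singular and has a nonzero kernel vector.\<close>
  have "transpose_mat M *\<^sub>v unit_vec n k = 0\<^sub>v n"
    using k by (intro eq_vecI) (auto simp: M_def)
  then have "det (transpose_mat M) = 0"
    using M k by (subst det_0_iff_vec_prod_zero[of _ n]) (auto intro!: exI[of _ "unit_vec n k"])
  then have "det M = 0" using det_transpose[OF M] by simp
  then obtain v where v: "v \<in> carrier_vec n" "v \<noteq> 0\<^sub>v n" and Mv: "M *\<^sub>v v = 0\<^sub>v n"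
    using det_0_iff_vec_prod_zero[OF M] by blast
  have v_tail: "v $ i = 0" if "k < i" "i < n" for i
  proof -
    have "row M i = unit_vec n i" using that by (intro eq_vecI) (auto simp: M_def)
    then have "(M *\<^sub>v v) $ i = v $ i" using that M v by simp
    then show ?thesis using Mv that by simp
  qed
  have w_head: "(W *\<^sub>v v) $ i = 0" if "i < k" for i
  proof -
    have i: "i < n" using that k by simp
    have "row M i = row W i" using that k W by (intro eq_vecI) (auto simp: M_def)
    then have "(M *\<^sub>v v) $ i = (W *\<^sub>v v) $ i" using i M W by simp
    then show ?thesis using Mv i by simp
  qed
  define x where "x = P *\<^sub>v v"
  have x: "x \<in> carrier_vec n" unfolding x_def using P v by simp
  have Px: "transpose_mat P *\<^sub>v x = v"
    unfolding x_def using P Pt v by (simp flip: assoc_mult_mat_vec[of _ n n _ n])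
  have Qx: "transpose_mat Q *\<^sub>v x = W *\<^sub>v v"
    unfolding x_def W_def using P Qt v by (simp add: assoc_mult_mat_vec[of _ n n _ n])
  define s where "s = v \<bullet> v"
  have "s > 0" unfolding s_def by (rule scalar_prod_self_pos[OF v])
  have sv: "(\<Sum>i<n. (v $ i)\<^sup>2) = s" unfolding s_def using scalar_prod_self_sum[OF v(1)] by simp
  have sx: "x \<bullet> x = s" using norm_orth[OF P x] sv by (simp add: Px)
  have sw: "(\<Sum>i<n. ((W *\<^sub>v v) $ i)\<^sup>2) = s" using norm_orth[OF Q x] by (simp add: Qx sx)
  \<comment> \<open>Only coordinates up to \<open>k\<close> survive here, and their eigenvalues are
    at least \<open>?a k\<close>. In the eigenbasis of \<open>Y\<close> only coordinates from
    \<open>k\<close> on survive, which gives the opposite bound below.\<close>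
  have "?a k * s = (\<Sum>i<n. ?a k * (v $ i)\<^sup>2)" by (simp add: sv flip: sum_distrib_left)
  also have "\<dots> \<le> (\<Sum>i<n. ?a i * (v $ i)\<^sup>2)"
  proof (rule sum_mono)
    fix i assume "i \<in> {..<n}"
    then show "?a k * (v $ i)\<^sup>2 \<le> ?a i * (v $ i)\<^sup>2"
      using v_tail[of i] a[of i k] k by (cases "k < i") (auto intro: mult_right_mono)
  qed
  also have "\<dots> = x \<bullet> (X *\<^sub>v x)"
    using quad_form_orth_diag[OF P(1) x, of ?a] by (simp add: Px flip: X_eq)
  finally have lower: "?a k * s \<le> x \<bullet> (X *\<^sub>v x)" .
  have "x \<bullet> (Y *\<^sub>v x) = (\<Sum>i<n. ?b i * ((W *\<^sub>v v) $ i)\<^sup>2)"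
    using quad_form_orth_diag[OF Q(1) x, of ?b] by (simp add: Qx flip: Y_eq)
  also have "\<dots> \<le> (\<Sum>i<n. ?b k * ((W *\<^sub>v v) $ i)\<^sup>2)"
  proof (rule sum_mono)
    fix i assume "i \<in> {..<n}"
    then show "?b i * ((W *\<^sub>v v) $ i)\<^sup>2 \<le> ?b k * ((W *\<^sub>v v) $ i)\<^sup>2"
      using w_head[of i] b[of k i] k by (cases "i < k") (auto intro: mult_right_mono)
  qed
  also have "\<dots> = ?b k * s" by (simp add: sw flip: sum_distrib_left)
  finally have "t * (x \<bullet> (X *\<^sub>v x)) + \<delta> * s \<le> ?b k * s" using le[OF x] sx by simp
  moreover have "t * (?a k * s) \<le> t * (x \<bullet> (X *\<^sub>v x))" by (rule mult_left_mono[OF lower t])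
  ultimately have "(t * ?a k + \<delta>) * s \<le> ?b k * s" by (simp add: algebra_simps)
  then show ?thesis using \<open>s > 0\<close> by simp
qed

lemma quad_form_sum:
  fixes X :: "real mat"
  assumes "X \<in> carrier_mat n n" "v \<in> carrier_vec n"
  shows "v \<bullet> (X *\<^sub>v v) = (\<Sum>i<n. \<Sum>j<n. X $$ (i, j) * (v $ i * v $ j))"
proof -
  have "(X *\<^sub>v v) $ i = (\<Sum>j<n. X $$ (i, j) * v $ j)" if "i < n" for i
    using assms that by (simp add: scalar_prod_def atLeast0LessThan)
  then have "v \<bullet> (X *\<^sub>v v) = (\<Sum>i<n. v $ i * (\<Sum>j<n. X $$ (i, j) * v $ j))"
    using assms by (simp add: scalar_prod_def atLeast0LessThan)
  then show ?thesis by (simp add: sum_distrib_left mult.left_commute)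
qed

text \<open>The two forms differ by at most the entrywise distance times
  \<open>v \<bullet> v\<close>, so \<open>eigval_mono\<close> applies with \<open>t = 1\<close> and
  minus that distance as the shift.\<close>

lemma eigval_le_add_entry_dist:
  fixes X Y :: "real mat"
  assumes X: "X \<in> carrier_mat n n" "transpose_mat X = X"
    and Y: "Y \<in> carrier_mat n n" "transpose_mat Y = Y" and k: "k < n"
  shows "eigval (Suc k) X \<le> eigval (Suc k) Y + (\<Sum>i<n. \<Sum>j<n. \<bar>X $$ (i, j) - Y $$ (i, j)\<bar>)"
proof -
  let ?S = "\<Sum>i<n. \<Sum>j<n. \<bar>X $$ (i, j) - Y $$ (i, j)\<bar>"
  have "1 * eigval (Suc k) X + (- ?S) \<le> eigval (Suc k) Y"
  proof (rule eigval_mono[OF X Y _ k])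
    fix v :: "real vec" assume v: "v \<in> carrier_vec n"
    have comp: "(v $ i)\<^sup>2 \<le> v \<bullet> v" if "i < n" for i
      unfolding scalar_prod_self_sum[OF v] using that by (intro member_le_sum) auto
    \<comment> \<open>Nonnegativity of the squares of \<open>v $ i - v $ j\<close> and
      \<open>v $ i + v $ j\<close> bounds the product by the mean of the two squares, each at most
      \<open>v \<bullet> v\<close>.\<close>
    have prod: "\<bar>v $ i * v $ j\<bar> \<le> v \<bullet> v" if "i < n" "j < n" for i j
      unfolding abs_le_iff
      using comp[OF that(1)] comp[OF that(2)] zero_le_power2[of "v $ i - v $ j"]
        zero_le_power2[of "v $ i + v $ j"]
      unfolding power2_sum power2_diff by linarith
    have "v \<bullet> (X *\<^sub>v v) - v \<bullet> (Y *\<^sub>v v)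
        = (\<Sum>i<n. \<Sum>j<n. (X $$ (i, j) - Y $$ (i, j)) * (v $ i * v $ j))"
      unfolding quad_form_sum[OF X(1) v] quad_form_sum[OF Y(1) v]
      by (simp add: sum_subtractf left_diff_distrib)
    also have "\<dots> \<le> (\<Sum>i<n. \<Sum>j<n. \<bar>X $$ (i, j) - Y $$ (i, j)\<bar> * (v \<bullet> v))"
    proof (intro sum_mono)
      fix i j assume "i \<in> {..<n}" "j \<in> {..<n}"
      then have "\<bar>X $$ (i, j) - Y $$ (i, j)\<bar> * \<bar>v $ i * v $ j\<bar> \<le> \<bar>X $$ (i, j) - Y $$ (i, j)\<bar> * (v \<bullet> v)"
        by (intro mult_left_mono prod) auto
      then show "(X $$ (i, j) - Y $$ (i, j)) * (v $ i * v $ j) \<le> \<bar>X $$ (i, j) - Y $$ (i, j)\<bar> * (v \<bullet> v)"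
        using abs_ge_self[of "(X $$ (i, j) - Y $$ (i, j)) * (v $ i * v $ j)"]
        unfolding abs_mult[of "X $$ (i, j) - Y $$ (i, j)" "v $ i * v $ j"] by linarith
    qed
    also have "\<dots> = ?S * (v \<bullet> v)" by (simp add: sum_distrib_right)
    finally show "1 * (v \<bullet> (X *\<^sub>v v)) + (- ?S) * (v \<bullet> v) \<le> v \<bullet> (Y *\<^sub>v v)" by simp
  qed simp
  then show ?thesis by simp
qed

lemma tendsto_eigval:
  fixes X :: "'a \<Rightarrow> real mat" and Y :: "real mat"
  assumes X: "\<And>e. X e \<in> carrier_mat n n" "\<And>e. transpose_mat (X e) = X e"
    and Y: "Y \<in> carrier_mat n n" "transpose_mat Y = Y" and k: "k < n"
    and lim: "\<And>i j. i < n \<Longrightarrow> j < n \<Longrightarrow> ((\<lambda>e. X e $$ (i, j)) \<longlongrightarrow> Y $$ (i, j)) F"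
  shows "((\<lambda>e. eigval (Suc k) (X e)) \<longlongrightarrow> eigval (Suc k) Y) F"
proof -
  let ?S = "\<lambda>e. \<Sum>i<n. \<Sum>j<n. \<bar>X e $$ (i, j) - Y $$ (i, j)\<bar>"
  have "(?S \<longlongrightarrow> (\<Sum>i<n. \<Sum>j<n. 0)) F"
    by (intro tendsto_sum tendsto_rabs_zero LIM_zero lim) auto
  then have lim0: "(?S \<longlongrightarrow> 0) F" by simp
  show ?thesis
  proof (rule LIM_zero_cancel, rule tendsto_rabs_zero_cancel, rule tendsto_sandwich[OF _ _ tendsto_const lim0])
    have "\<bar>eigval (Suc k) (X e) - eigval (Suc k) Y\<bar> \<le> ?S e" for e
      using eigval_le_add_entry_dist[OF X[of e] Y k] eigval_le_add_entry_dist[OF Y X[of e] k]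
      by (simp add: abs_minus_commute)
    then show "\<forall>\<^sub>F e in F. \<bar>eigval (Suc k) (X e) - eigval (Suc k) Y\<bar> \<le> ?S e" by simp
  qed simp
qed

section \<open>Signs of eigenvalues and the determinant as their product\<close>

lemma eigval_attained:
  fixes A :: "real mat"
  assumes A: "A \<in> carrier_mat n n" "transpose_mat A = A" and k: "k < n"
  shows "\<exists>x \<in> carrier_vec n. x \<noteq> 0\<^sub>v n \<and> x \<bullet> (A *\<^sub>v x) = eigval (Suc k) A"
proof -
  let ?a = "\<lambda>i. eigval (Suc i) A"
  obtain P where P: "P \<in> carrier_mat n n" "transpose_mat P * P = 1\<^sub>m n"
    and A_eq: "A = P * mat_diag n ?a * transpose_mat P"
    using eigval_diagonalize[OF A] by blast
  have Pt: "transpose_mat P \<in> carrier_mat n n" using P by simp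
  define x where "x = P *\<^sub>v unit_vec n k"
  have x: "x \<in> carrier_vec n" unfolding x_def using P by simp
  have Px: "transpose_mat P *\<^sub>v x = unit_vec n k"
    unfolding x_def using P Pt by (simp flip: assoc_mult_mat_vec[of _ n n _ n])
  have x0: "x \<noteq> 0\<^sub>v n"
  proof
    assume "x = 0\<^sub>v n"
    moreover have "transpose_mat P *\<^sub>v 0\<^sub>v n = 0\<^sub>v n"
      using Pt by (intro eq_vecI) auto
    ultimately have "unit_vec n k = (0\<^sub>v n :: real vec)" using Px by simp
    then show False using k by (metis unit_vec_nonzero)
  qed
  have "x \<bullet> (A *\<^sub>v x) = (\<Sum>i<n. ?a i * (unit_vec n k $ i)\<^sup>2)"
    using quad_form_orth_diag[OF P(1) x, of ?a] by (simp add: Px flip: A_eq)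
  also have "\<dots> = (\<Sum>i<n. if i = k then ?a k else 0)"
    by (rule sum.cong) (auto simp: k)
  also have "\<dots> = ?a k" using k by simp
  finally show ?thesis using x x0 by blast
qed

lemma eigval_pos:
  assumes "A \<in> carrier_mat n n" "pos_def A" "k < n"
  shows "eigval (Suc k) A > 0"
  using assms eigval_attained[of A n k] unfolding pos_def_def by (metis carrier_matD(1))

lemma eigval_nonneg:
  assumes "A \<in> carrier_mat n n" "pos_semidef A" "k < n"
  shows "eigval (Suc k) A \<ge> 0"
  using assms eigval_attained[of A n k] unfolding pos_semidef_def by (metis carrier_matD(1))

lemma det_orth_diag:
  fixes U :: "real mat"
  assumes U: "U \<in> carrier_mat n n" and orth: "transpose_mat U * U = 1\<^sub>m n"
  shows "det (U * mat_diag n d * transpose_mat U) = (\<Prod>i<n. d i)"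
proof -
  have Ut: "transpose_mat U \<in> carrier_mat n n" using U by simp
  have "det (transpose_mat U) * det U = 1"
    using det_mult[OF Ut U] orth by simp
  moreover have "det (mat_diag n d) = prod_list (diag_mat (mat_diag n d))"
    by (rule det_upper_triangular[of _ n]) (auto simp: mat_diag_def)
  then have "det (mat_diag n d) = (\<Prod>i<n. d i)"
    unfolding prod_list_diag_prod by (simp add: mat_diag_def atLeast0LessThan)
  ultimately show ?thesis
    using U Ut by (simp add: det_mult[of _ n] det_transpose[of _ n])
qed

lemma det_eq_prod_eigval:
  fixes A :: "real mat"
  assumes A: "A \<in> carrier_mat n n" "transpose_mat A = A"
  shows "det A = (\<Prod>i<n. eigval (Suc i) A)"
proof -
  obtain U where U: "U \<in> carrier_mat n n" "transpose_mat U * U = 1\<^sub>m n"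
    and A_eq: "A = U * mat_diag n (\<lambda>i. eigval (Suc i) A) * transpose_mat U"
    using eigval_diagonalize[OF A] by blast
  show ?thesis
    using det_orth_diag[OF U, of "\<lambda>i. eigval (Suc i) A"] by (simp flip: A_eq)
qed

section \<open>Positive semidefinite square roots\<close>

lemma orth_diag_mult:
  fixes U :: "real mat"
  assumes U: "U \<in> carrier_mat n n" and orth: "transpose_mat U * U = 1\<^sub>m n"
  shows "(U * mat_diag n d * transpose_mat U) * (U * mat_diag n e * transpose_mat U) =
    U * mat_diag n (\<lambda>i. d i * e i) * transpose_mat U"
proof -
  have Ut: "transpose_mat U \<in> carrier_mat n n" using U by simp
  define D where "D = mat_diag n d"
  define E where "E = mat_diag n e"
  have D: "D \<in> carrier_mat n n" and E: "E \<in> carrier_mat n n" unfolding D_def E_def by auto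
  have "(U * D * transpose_mat U) * (U * E * transpose_mat U)
    = U * (D * ((transpose_mat U * U) * E)) * transpose_mat U"
    using U Ut D E by (simp add: assoc_mult_mat[of _ n n _ n _ n])
  also have "\<dots> = U * (D * E) * transpose_mat U" using E by (simp add: orth)
  finally show ?thesis unfolding D_def E_def by simp
qed

lemma transpose_orth_diag:
  fixes U :: "real mat"
  assumes U: "U \<in> carrier_mat n n"
  shows "transpose_mat (U * mat_diag n d * transpose_mat U) = U * mat_diag n d * transpose_mat U"
proof -
  have Ut: "transpose_mat U \<in> carrier_mat n n" using U by simp
  define D where "D = mat_diag n d"
  have D: "D \<in> carrier_mat n n" "transpose_mat D = D"
    unfolding D_def by (auto simp: mat_diag_def)
  then show ?thesis
    unfolding D_def[symmetric] using U Ut D by (simp add: transpose_mult[of _ n n _ n] assoc_mult_mat[of _ n n _ n _ n])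
qed

lemma orth_diag_carrier:
  assumes "U \<in> carrier_mat n n"
  shows "U * mat_diag n d * transpose_mat U \<in> carrier_mat n n"
  using assms by (intro mult_carrier_mat[of _ n n]) auto

lemma pos_semidef_orth_diag:
  fixes U :: "real mat"
  assumes U: "U \<in> carrier_mat n n" and d: "\<And>i. i < n \<Longrightarrow> d i \<ge> 0"
  shows "pos_semidef (U * mat_diag n d * transpose_mat U)"
proof -
  have "v \<bullet> ((U * mat_diag n d * transpose_mat U) *\<^sub>v v) \<ge> 0" if v: "v \<in> carrier_vec n" for v
    unfolding quad_form_orth_diag[OF U v] using d by (intro sum_nonneg) simp
  then show ?thesis unfolding pos_semidef_def transpose_orth_diag[OF U] using U by simp
qed

lemma pos_def_imp_semidef:
  fixes A :: "real mat"
  assumes "A \<in> carrier_mat n n" "pos_def A"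
  shows "pos_semidef A"
  unfolding pos_semidef_def
proof (intro conjI ballI)
  fix v :: "real vec" assume v: "v \<in> carrier_vec (dim_row A)"
  show "v \<bullet> (A *\<^sub>v v) \<ge> 0"
  proof (cases "v = 0\<^sub>v (dim_row A)")
    case True
    then show ?thesis using assms(1) by simp
  next
    case False
    then show ?thesis using assms(2) v unfolding pos_def_def by (simp add: less_imp_le)
  qed
qed (use assms(2) in \<open>simp add: pos_def_def\<close>)

text \<open>The change of basis \<open>W\<close> between the eigenbases intertwines the squared
  diagonals. Nonnegative numbers with equal squares are equal, so wherever an entry of
  \<open>W\<close> is nonzero the unsquared eigenvalues agree too, and \<open>W\<close> intertwines
  the roots themselves.\<close>

lemma psd_square_unique:
  assumes C: "C \<in> carrier_mat n n" "pos_semidef C" and C': "C' \<in> carrier_mat n n" "pos_semidef C'"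
    and eq: "C * C = C' * C'"
  shows "C = C'"
proof -
  let ?s = "\<lambda>i. eigval (Suc i) C" and ?t = "\<lambda>i. eigval (Suc i) C'"
  have sym: "transpose_mat C = C" "transpose_mat C' = C'"
    using C C' unfolding pos_semidef_def by auto
  obtain U where U: "U \<in> carrier_mat n n" "transpose_mat U * U = 1\<^sub>m n"
    and C_eq: "C = U * mat_diag n ?s * transpose_mat U"
    using eigval_diagonalize[OF C(1) sym(1)] by blast
  obtain V where V: "V \<in> carrier_mat n n" "transpose_mat V * V = 1\<^sub>m n"
    and C'_eq: "C' = V * mat_diag n ?t * transpose_mat V"
    using eigval_diagonalize[OF C'(1) sym(2)] by blast
  have Ut: "transpose_mat U \<in> carrier_mat n n" and Vt: "transpose_mat V \<in> carrier_mat n n"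
    using U V by auto
  have UU: "U * transpose_mat U = 1\<^sub>m n" by (rule mat_mult_left_right_inverse[OF Ut U])
  have VV: "V * transpose_mat V = 1\<^sub>m n" by (rule mat_mult_left_right_inverse[OF Vt V])
  note assoc = assoc_mult_mat[of _ n n _ n _ n]
  define W where "W = transpose_mat V * U"
  have W: "W \<in> carrier_mat n n" unfolding W_def using U V by simp
  have conj1: "transpose_mat V * (U * mat_diag n d * transpose_mat U) * U = W * mat_diag n d" for d
  proof -
    define D where "D = mat_diag n d"
    have D: "D \<in> carrier_mat n n" unfolding D_def by simp
    have "transpose_mat V * (U * D * transpose_mat U) * U = W * (D * (transpose_mat U * U))"
      unfolding W_def using U(1) Ut Vt D by (simp add: assoc)
    then show ?thesis unfolding D_def[symmetric] using D by (simp add: U(2))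
  qed
  have conj2: "transpose_mat V * (V * mat_diag n d * transpose_mat V) * U = mat_diag n d * W" for d
  proof -
    define D where "D = mat_diag n d"
    have D: "D \<in> carrier_mat n n" unfolding D_def by simp
    have "transpose_mat V * (V * D * transpose_mat V) * U = (transpose_mat V * V) * D * W"
      unfolding W_def using U V(1) Vt D by (simp add: assoc)
    then show ?thesis unfolding D_def[symmetric] using D by (simp add: V(2))
  qed
  have sq: "C * C = U * mat_diag n (\<lambda>i. ?s i * ?s i) * transpose_mat U"
    using orth_diag_mult[OF U, of ?s ?s] by (simp flip: C_eq)
  have sq': "C' * C' = V * mat_diag n (\<lambda>i. ?t i * ?t i) * transpose_mat V"
    using orth_diag_mult[OF V, of ?t ?t] by (simp flip: C'_eq)
  have comm2: "W * mat_diag n (\<lambda>i. ?s i * ?s i) = mat_diag n (\<lambda>i. ?t i * ?t i) * W"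
    using conj1 conj2 sq sq' eq by metis
  have comm: "W * mat_diag n ?s = mat_diag n ?t * W"
  proof (rule eq_matI)
    fix i j assume "i < dim_row (mat_diag n ?t * W)" "j < dim_col (mat_diag n ?t * W)"
    then have ij: "i < n" "j < n" using W by (auto simp: mat_diag_def)
    have "(W * mat_diag n (\<lambda>i. ?s i * ?s i)) $$ (i, j) = (mat_diag n (\<lambda>i. ?t i * ?t i) * W) $$ (i, j)"
      by (simp only: comm2)
    then have "W $$ (i, j) * (?s j * ?s j) = ?t i * ?t i * W $$ (i, j)"
      unfolding mat_diag_mult_right[OF W] mat_diag_mult_left[OF W] using ij by simp
    then have "W $$ (i, j) = 0 \<or> ?s j * ?s j = ?t i * ?t i" by (simp add: mult.commute)
    moreover have "?s j \<ge> 0" "?t i \<ge> 0"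
      using eigval_nonneg[OF C] eigval_nonneg[OF C'] ij by auto
    ultimately have "W $$ (i, j) * ?s j = ?t i * W $$ (i, j)"
      by (metis abs_of_nonneg mult.commute mult_zero_left real_sqrt_mult_self real_sqrt_abs2)
    then show "(W * mat_diag n ?s) $$ (i, j) = (mat_diag n ?t * W) $$ (i, j)"
      unfolding mat_diag_mult_right[OF W] mat_diag_mult_left[OF W] using ij by simp
  qed (use W in \<open>auto simp: mat_diag_def\<close>)
  have "transpose_mat V * C * U = transpose_mat V * C' * U"
    using comm conj1[of ?s] conj2[of ?t] by (simp flip: C_eq C'_eq)
  then have "V * (transpose_mat V * C * U) * transpose_mat U = V * (transpose_mat V * C' * U) * transpose_mat U"
    by simp
  moreover have "V * (transpose_mat V * X * U) * transpose_mat U = X" if X: "X \<in> carrier_mat n n" for X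
  proof -
    have "V * (transpose_mat V * X * U) * transpose_mat U = (V * transpose_mat V) * (X * (U * transpose_mat U))"
      using U V Ut Vt X by (simp add: assoc)
    then show ?thesis using X by (simp add: UU VV)
  qed
  ultimately show ?thesis using C C' by simp
qed

lemma psd_sqrt_eqI:
  assumes C: "C \<in> carrier_mat n n" "pos_semidef C"
  shows "psd_sqrt (C * C) = C"
  unfolding psd_sqrt_def
proof (rule the_equality)
  fix D assume D: "pos_semidef D \<and> D * D = C * C"
  \<comment> \<open>The description in \<open>psd_sqrt\<close> fixes no size for the competitor
    \<open>D\<close>; the product gives its row count and symmetry makes it square.\<close>
  then have "dim_row D = n" using C by (metis carrier_matD(1) index_mult_mat(2))
  moreover have "dim_col D = dim_row D"
    using D unfolding pos_semidef_def by (metis index_transpose_mat(2))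
  ultimately have "D \<in> carrier_mat n n" by auto
  then show "D = C" using psd_square_unique C D by blast
qed (use C in simp)

text \<open>One \<open>U\<close> serves both \<open>B\<close> and its root, which later lets the
  inverse root be written down in the same basis.\<close>

lemma psd_sqrt_diagonalize:
  assumes B: "B \<in> carrier_mat n n" "pos_semidef B"
  shows "\<exists>U \<in> carrier_mat n n. transpose_mat U * U = 1\<^sub>m n \<and>
    B = U * mat_diag n (\<lambda>i. eigval (Suc i) B) * transpose_mat U \<and>
    psd_sqrt B = U * mat_diag n (\<lambda>i. sqrt (eigval (Suc i) B)) * transpose_mat U"
proof -
  let ?b = "\<lambda>i. eigval (Suc i) B"
  have sym: "transpose_mat B = B" using B unfolding pos_semidef_def by simp
  obtain U where U: "U \<in> carrier_mat n n" "transpose_mat U * U = 1\<^sub>m n"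
    and B_eq: "B = U * mat_diag n ?b * transpose_mat U"
    using eigval_diagonalize[OF B(1) sym] by blast
  define C where "C = U * mat_diag n (\<lambda>i. sqrt (?b i)) * transpose_mat U"
  have nonneg: "?b i \<ge> 0" if "i < n" for i using eigval_nonneg[OF B that] .
  have "C * C = U * mat_diag n (\<lambda>i. sqrt (?b i) * sqrt (?b i)) * transpose_mat U"
    unfolding C_def by (rule orth_diag_mult[OF U])
  also have "mat_diag n (\<lambda>i. sqrt (?b i) * sqrt (?b i)) = mat_diag n ?b"
    unfolding mat_diag_def using nonneg by (intro eq_matI) auto
  finally have "C * C = B" using B_eq by simp
  moreover have "C \<in> carrier_mat n n" unfolding C_def by (rule orth_diag_carrier[OF U(1)])
  moreover have "pos_semidef C" unfolding C_def using nonneg by (intro pos_semidef_orth_diag[OF U(1)]) simp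
  ultimately have "psd_sqrt B = C" using psd_sqrt_eqI by metis
  then show ?thesis using U B_eq C_def by blast
qed

lemma psd_sqrt_props:
  assumes B: "B \<in> carrier_mat n n" "pos_semidef B"
  shows "psd_sqrt B \<in> carrier_mat n n" "pos_semidef (psd_sqrt B)" "psd_sqrt B * psd_sqrt B = B"
proof -
  let ?b = "\<lambda>i. eigval (Suc i) B"
  obtain U where U: "U \<in> carrier_mat n n" "transpose_mat U * U = 1\<^sub>m n"
    and B_eq: "B = U * mat_diag n ?b * transpose_mat U"
    and C_eq: "psd_sqrt B = U * mat_diag n (\<lambda>i. sqrt (?b i)) * transpose_mat U"
    using psd_sqrt_diagonalize[OF B] by blast
  have nonneg: "?b i \<ge> 0" if "i < n" for i using eigval_nonneg[OF B that] .
  show "psd_sqrt B \<in> carrier_mat n n" unfolding C_eq by (rule orth_diag_carrier[OF U(1)])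
  show "pos_semidef (psd_sqrt B)"
    unfolding C_eq using nonneg by (intro pos_semidef_orth_diag[OF U(1)]) simp
  have "mat_diag n (\<lambda>i. sqrt (?b i) * sqrt (?b i)) = mat_diag n ?b"
    unfolding mat_diag_def using nonneg by (intro eq_matI) auto
  then show "psd_sqrt B * psd_sqrt B = B"
    using orth_diag_mult[OF U, of "\<lambda>i. sqrt (?b i)" "\<lambda>i. sqrt (?b i)"] B_eq C_eq by simp
qed

section \<open>The multiplicative Lidskii inequality\<close>

lemma quad_form_congruence:
  fixes S :: "real mat"
  assumes S: "S \<in> carrier_mat n n" and A: "A \<in> carrier_mat n n" and v: "v \<in> carrier_vec n"
  shows "v \<bullet> ((transpose_mat S * A * S) *\<^sub>v v) = (S *\<^sub>v v) \<bullet> (A *\<^sub>v (S *\<^sub>v v))"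
proof -
  have St: "transpose_mat S \<in> carrier_mat n n" using S by simp
  have w: "A *\<^sub>v (S *\<^sub>v v) \<in> carrier_vec n" using A S v by simp
  have "v \<bullet> ((transpose_mat S * A * S) *\<^sub>v v) = v \<bullet> (transpose_mat S *\<^sub>v (A *\<^sub>v (S *\<^sub>v v)))"
    using S St A v by (simp add: assoc_mult_mat_vec[of _ n n _ n])
  also have "\<dots> = (S *\<^sub>v v) \<bullet> (A *\<^sub>v (S *\<^sub>v v))"
    using transpose_vec_mult_scalar[OF St w v] by simp
  finally show ?thesis .
qed

lemma transpose_congruence:
  fixes S :: "real mat"
  assumes "S \<in> carrier_mat n n" "A \<in> carrier_mat n n" "transpose_mat A = A"
  shows "transpose_mat (transpose_mat S * A * S) = transpose_mat S * A * S"
proof -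
  have "transpose_mat S \<in> carrier_mat n n" using assms by simp
  then show ?thesis
    using assms by (simp add: transpose_mult[of _ n n _ n] assoc_mult_mat[of _ n n _ n _ n])
qed

lemma pos_def_congruence:
  fixes S :: "real mat"
  assumes S: "S \<in> carrier_mat n n" "det S \<noteq> 0" and A: "A \<in> carrier_mat n n" "pos_def A"
  shows "pos_def (transpose_mat S * A * S)"
proof -
  have "v \<bullet> ((transpose_mat S * A * S) *\<^sub>v v) > 0" if v: "v \<in> carrier_vec n" "v \<noteq> 0\<^sub>v n" for v
  proof -
    have "S *\<^sub>v v \<noteq> 0\<^sub>v n" using S v det_0_iff_vec_prod_zero[OF S(1)] by blast
    moreover have "S *\<^sub>v v \<in> carrier_vec n" using S v by simp
    ultimately show ?thesis
      using A unfolding quad_form_congruence[OF S(1) A(1) v(1)] pos_def_def by simp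
  qed
  then show ?thesis
    using transpose_congruence[OF S(1) A(1)] A S unfolding pos_def_def by simp
qed

lemma pos_def_one: "pos_def (1\<^sub>m n)"
  unfolding pos_def_def by (auto intro: scalar_prod_self_pos)

lemma pos_def_det_pos:
  assumes "A \<in> carrier_mat n n" "pos_def A"
  shows "det A > 0"
proof -
  have sym: "transpose_mat A = A" using assms(2) unfolding pos_def_def by simp
  show ?thesis
    using eigval_pos[OF assms] unfolding det_eq_prod_eigval[OF assms(1) sym]
    by (intro prod_pos) simp
qed

text \<open>
  The argument of Li and Mathias: lifting the eigenvalues of \<open>A\<close> below \<open>t = \<lambda>\<^sub>k(A)\<close> up to \<open>t\<close> makes all
  ratios \<open>\<lambda>\<^sub>i(S\<^sup>T A\<^sub>+ S) / (t \<lambda>\<^sub>i(S\<^sup>T S))\<close> at least 1, so the product over \<open>I\<close> is at most the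
  product over all indices, which is a determinant.
\<close>
lemma prod_eigval_congruence_le:
  assumes A: "A \<in> carrier_mat n n" "pos_def A" and S: "S \<in> carrier_mat n n" "det S \<noteq> 0"
    and I: "I \<subseteq> {..<n}"
  shows "(\<Prod>i\<in>I. eigval (Suc i) (transpose_mat S * A * S)) \<le>
    (\<Prod>i\<in>I. eigval (Suc i) (transpose_mat S * S)) * (\<Prod>i<card I. eigval (Suc i) A)"
proof (cases "I = {}")
  case False
  let ?a = "\<lambda>i. eigval (Suc i) A"
  have finI: "finite I" using I finite_subset by blast
  have cardI: "0 < card I" "card I \<le> n"
    using False finI I card_mono[OF _ I] by (auto simp: card_gt_0_iff)
  \<comment> \<open>\<open>?a\<close> is indexed from 0, so this is the eigenvalue number
    \<open>card I\<close> counted from the largest.\<close>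
  define t where "t = ?a (card I - 1)"
  have t: "t > 0" unfolding t_def by (rule eigval_pos[OF A]) (use cardI in simp)
  have symA: "transpose_mat A = A" using A unfolding pos_def_def by simp
  note a_anti = eigval_antimono[OF A(1) symA]
  obtain U where U: "U \<in> carrier_mat n n" "transpose_mat U * U = 1\<^sub>m n"
    and A_eq: "A = U * mat_diag n ?a * transpose_mat U"
    using eigval_diagonalize[OF A(1) symA] by blast
  define A' where "A' = U * mat_diag n (\<lambda>i. max (?a i) t) * transpose_mat U"
  have A': "A' \<in> carrier_mat n n" unfolding A'_def by (rule orth_diag_carrier[OF U(1)])
  have symA': "transpose_mat A' = A'" unfolding A'_def by (rule transpose_orth_diag[OF U(1)])
  \<comment> \<open>\<open>A'\<close> dominates both \<open>A\<close> and \<open>t\<close> times the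
    identity as a quadratic form. Congruence by \<open>S\<close> preserves both comparisons, which
    yields \<open>c_le\<close> and \<open>b_le\<close>.\<close>
  have A_le: "v \<bullet> (A *\<^sub>v v) \<le> v \<bullet> (A' *\<^sub>v v)" if v: "v \<in> carrier_vec n" for v
  proof -
    have "v \<bullet> (A *\<^sub>v v) = (\<Sum>i<n. ?a i * ((transpose_mat U *\<^sub>v v) $ i)\<^sup>2)"
      using quad_form_orth_diag[OF U(1) v, of ?a] by (simp flip: A_eq)
    also have "\<dots> \<le> (\<Sum>i<n. max (?a i) t * ((transpose_mat U *\<^sub>v v) $ i)\<^sup>2)"
      by (intro sum_mono mult_right_mono) auto
    finally show ?thesis unfolding A'_def quad_form_orth_diag[OF U(1) v] .
  qed
  have t_le: "t * (v \<bullet> v) \<le> v \<bullet> (A' *\<^sub>v v)" if v: "v \<in> carrier_vec n" for v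
  proof -
    have "t * (v \<bullet> v) = (\<Sum>i<n. t * ((transpose_mat U *\<^sub>v v) $ i)\<^sup>2)"
      unfolding norm_orth[OF U v, symmetric] by (rule sum_distrib_left)
    also have "\<dots> \<le> (\<Sum>i<n. max (?a i) t * ((transpose_mat U *\<^sub>v v) $ i)\<^sup>2)"
      by (intro sum_mono mult_right_mono) auto
    finally show ?thesis unfolding A'_def quad_form_orth_diag[OF U(1) v] .
  qed
  have St: "transpose_mat S \<in> carrier_mat n n" using S by simp
  let ?B = "transpose_mat S * S"
  let ?C = "transpose_mat S * A * S" and ?C' = "transpose_mat S * A' * S"
  \<comment> \<open>Viewing \<open>?B\<close> as the congruence of the identity makes the congruence
    lemmas apply to it.\<close>
  have B_eq: "?B = transpose_mat S * 1\<^sub>m n * S" using St by simp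
  have B: "?B \<in> carrier_mat n n" "transpose_mat ?B = ?B" "pos_def ?B"
    unfolding B_eq using St S transpose_congruence[OF S(1), of "1\<^sub>m n"]
      pos_def_congruence[OF S one_carrier_mat pos_def_one] by auto
  have C: "?C \<in> carrier_mat n n" "transpose_mat ?C = ?C" "pos_def ?C"
    using St S A transpose_congruence[OF S(1) A(1) symA] pos_def_congruence[OF S A] by auto
  have C': "?C' \<in> carrier_mat n n" "transpose_mat ?C' = ?C'"
    using St S A' transpose_congruence[OF S(1) A' symA'] by auto
  let ?b = "\<lambda>i. eigval (Suc i) ?B" and ?c = "\<lambda>i. eigval (Suc i) ?C"
    and ?c' = "\<lambda>i. eigval (Suc i) ?C'"
  have b_pos: "?b i > 0" if "i < n" for i using eigval_pos[OF B(1,3) that] .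
  have c_le: "?c i \<le> ?c' i" if "i < n" for i
  proof -
    have "1 * ?c i + 0 \<le> ?c' i"
    proof (rule eigval_mono[OF C(1,2) C' _ that])
      fix v :: "real vec" assume v: "v \<in> carrier_vec n"
      then show "1 * (v \<bullet> (?C *\<^sub>v v)) + 0 * (v \<bullet> v) \<le> v \<bullet> (?C' *\<^sub>v v)"
        unfolding quad_form_congruence[OF S(1) A(1) v] quad_form_congruence[OF S(1) A' v]
        using A_le[of "S *\<^sub>v v"] S by simp
    qed simp
    then show ?thesis by simp
  qed
  have b_le: "t * ?b i \<le> ?c' i" if "i < n" for i
  proof -
    have "t * ?b i + 0 \<le> ?c' i"
    proof (rule eigval_mono[OF B(1,2) C' _ that])
      fix v :: "real vec" assume v: "v \<in> carrier_vec n"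
      have "v \<bullet> (?B *\<^sub>v v) = (S *\<^sub>v v) \<bullet> (S *\<^sub>v v)"
        unfolding B_eq quad_form_congruence[OF S(1) one_carrier_mat v] using S v by simp
      then show "t * (v \<bullet> (?B *\<^sub>v v)) + 0 * (v \<bullet> v) \<le> v \<bullet> (?C' *\<^sub>v v)"
        unfolding quad_form_congruence[OF S(1) A' v] using t_le[of "S *\<^sub>v v"] S v by simp
    qed (use t in simp)
    then show ?thesis by simp
  qed
  define q where "q i = ?c' i / (t * ?b i)" for i
  have q_ge: "q i \<ge> 1" if "i < n" for i
    unfolding q_def using b_le[OF that] b_pos[OF that] t by simp
  have c'_eq: "?c' i = t * ?b i * q i" if "i < n" for i
    unfolding q_def using b_pos[OF that] t by simp
  \<comment> \<open>Individual eigenvalues of a product are out of reach, but their full product is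
    a determinant and hence multiplicative.\<close>
  have det_eq: "(\<Prod>i<n. ?c' i) = (\<Prod>i<n. ?b i) * (\<Prod>i<n. max (?a i) t)"
  proof -
    have "det ?C' = det ?B * det A'"
      using S St A' by (simp add: det_mult[of _ n])
    moreover have "det A' = (\<Prod>i<n. max (?a i) t)" unfolding A'_def by (rule det_orth_diag[OF U])
    ultimately show ?thesis
      using det_eq_prod_eigval[OF C'] det_eq_prod_eigval[OF B(1,2)] by simp
  qed
  have "(\<Prod>i<n. t * ?b i) * (\<Prod>i<n. q i) = (\<Prod>i<n. ?c' i)"
    unfolding prod.distrib[symmetric] by (rule prod.cong) (auto simp: c'_eq)
  also have "\<dots> = (\<Prod>i<n. t * ?b i) * (\<Prod>i<n. max (?a i) t / t)"
    unfolding det_eq prod.distrib[symmetric] using t by (intro prod.cong) auto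
  finally have total: "(\<Prod>i<n. t * ?b i) * (\<Prod>i<n. q i)
    = (\<Prod>i<n. t * ?b i) * (\<Prod>i<n. max (?a i) t / t)" .
  have "(\<Prod>i<n. t * ?b i) > 0" by (intro prod_pos) (use t b_pos in auto)
  note nz = less_imp_neq[OF this, symmetric]
  have "(\<Prod>i<n. q i) = (\<Prod>i<n. max (?a i) t / t)"
    using total unfolding mult_left_cancel[OF nz] .
  \<comment> \<open>The eigenvalues from index \<open>card I\<close> on were lifted to exactly
    \<open>t\<close> and contribute 1; the earlier ones were at least \<open>t\<close> and are
    unchanged.\<close>
  also have "\<dots> = (\<Prod>i<card I. ?a i / t)"
  proof (rule prod.mono_neutral_cong_right)
    show "\<forall>i\<in>{..<n} - {..<card I}. max (?a i) t / t = 1"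
    proof
      fix i assume i: "i \<in> {..<n} - {..<card I}"
      then have "?a i \<le> t" unfolding t_def by (intro a_anti) auto
      then show "max (?a i) t / t = 1" using t by simp
    qed
    fix i assume "i \<in> {..<card I}"
    then have "t \<le> ?a i" unfolding t_def using cardI by (intro a_anti) auto
    then show "max (?a i) t / t = ?a i / t" by simp
  qed (use cardI in auto)
  also have "\<dots> = (\<Prod>i<card I. ?a i) / t ^ card I" by (simp add: prod_dividef)
  finally have prod_q: "(\<Prod>i<n. q i) = (\<Prod>i<card I. ?a i) / t ^ card I" .
  have "(\<Prod>i\<in>I. q i) \<le> (\<Prod>i\<in>I. q i) * (\<Prod>i\<in>{..<n} - I. q i)"
  proof -
    have "1 \<le> (\<Prod>i\<in>{..<n} - I. q i)" by (intro prod_ge_1) (use q_ge in auto)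
    moreover have "0 \<le> (\<Prod>i\<in>I. q i)" by (intro prod_nonneg) (use q_ge I in force)
    ultimately show ?thesis using mult_left_mono by fastforce
  qed
  also have "\<dots> = (\<Prod>i<n. q i)"
    using prod.subset_diff[OF I, of q] by (simp add: mult.commute)
  finally have q_le: "(\<Prod>i\<in>I. q i) \<le> (\<Prod>i<card I. ?a i) / t ^ card I" unfolding prod_q .
  have "(\<Prod>i\<in>I. ?c i) \<le> (\<Prod>i\<in>I. ?c' i)"
    by (intro prod_mono) (use I c_le eigval_pos[OF C(1,3)] in \<open>force simp: less_imp_le\<close>)
  also have "\<dots> = t ^ card I * (\<Prod>i\<in>I. ?b i) * (\<Prod>i\<in>I. q i)"
  proof -
    have "(\<Prod>i\<in>I. ?c' i) = (\<Prod>i\<in>I. t * ?b i * q i)"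
      by (rule prod.cong) (use I c'_eq in auto)
    then show ?thesis by (simp add: prod.distrib)
  qed
  \<comment> \<open>The power of \<open>t\<close> released by the set \<open>I\<close> cancels
    against the one in \<open>q_le\<close>, because \<open>t\<close> was chosen at position
    \<open>card I\<close>.\<close>
  also have "\<dots> \<le> t ^ card I * (\<Prod>i\<in>I. ?b i) * ((\<Prod>i<card I. ?a i) / t ^ card I)"
  proof (rule mult_left_mono[OF q_le])
    have "(\<Prod>i\<in>I. ?b i) \<ge> 0" by (intro prod_nonneg) (use b_pos I in \<open>force simp: less_imp_le\<close>)
    then show "0 \<le> t ^ card I * (\<Prod>i\<in>I. ?b i)" using t by simp
  qed
  also have "\<dots> = (\<Prod>i\<in>I. ?b i) * (\<Prod>i<card I. ?a i)" using t by simp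
  finally show ?thesis .
qed simp

section \<open>Karamata's inequality in logarithmic coordinates\<close>

text \<open>This is the tangent inequality at \<open>ln x\<close> for the function
  \<open>f (exp t)\<close>, whose derivative \<open>exp t * f' (exp t)\<close> is nondecreasing. The
  mean value theorem is applied on either side of \<open>x\<close>.\<close>

lemma log_tangent_ineq:
  fixes f f' :: "real \<Rightarrow> real"
  assumes deriv: "\<And>s. 0 < s \<Longrightarrow> (f has_real_derivative f' s) (at s)"
    and mono: "mono_on {0<..} (\<lambda>s. s * f' s)" and x: "x > 0" and y: "y > 0"
  shows "x * f' x * (ln y - ln x) \<le> f y - f x"
proof -
  have deriv_exp: "((\<lambda>t. f (exp t)) has_real_derivative f' (exp t) * exp t) (at t)" for t
    using DERIV_chain2[OF deriv[of "exp t"] DERIV_exp] by simp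
  have mvt: "\<exists>z > 0. p \<le> z \<and> z \<le> q \<and> f q - f p = (ln q - ln p) * (z * f' z)"
    if pq: "0 < p" "p < q" for p q
  proof -
    have "ln p < ln q" using pq by simp
    then obtain t where t: "ln p < t" "t < ln q"
      and eq: "f (exp (ln q)) - f (exp (ln p)) = (ln q - ln p) * (f' (exp t) * exp t)"
      using MVT2[of "ln p" "ln q" "\<lambda>t. f (exp t)" "\<lambda>t. f' (exp t) * exp t"] deriv_exp by blast
    have "exp (ln p) \<le> exp t" "exp t \<le> exp (ln q)" using t by (simp_all del: exp_ln)
    then show ?thesis using eq pq by (intro exI[of _ "exp t"]) (simp add: mult.commute)
  qed
  consider "x < y" | "x = y" | "y < x" by linarith
  then show ?thesis
  proof cases
    case 1
    obtain z where z: "z > 0" "x \<le> z" and eq: "f y - f x = (ln y - ln x) * (z * f' z)"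
      using mvt[OF x 1] by blast
    have "x * f' x \<le> z * f' z" using mono_onD[OF mono] x z by simp
    then have "(ln y - ln x) * (x * f' x) \<le> (ln y - ln x) * (z * f' z)"
      using 1 x y by (intro mult_left_mono) auto
    then show ?thesis using eq by (simp add: mult.commute)
  next
    case 3
    obtain z where z: "z > 0" "z \<le> x" and eq: "f x - f y = (ln x - ln y) * (z * f' z)"
      using mvt[OF y 3] by blast
    have "z * f' z \<le> x * f' x" using mono_onD[OF mono] x z by simp
    then have "(ln x - ln y) * (z * f' z) \<le> (ln x - ln y) * (x * f' x)"
      using 3 x y by (intro mult_left_mono) auto
    then show ?thesis using eq by (simp add: algebra_simps)
  qed simp
qed

lemma sum_mult_antitone_nonneg:
  fixes h d :: "nat \<Rightarrow> real"
  assumes anti: "\<And>i j. i \<le> j \<Longrightarrow> j < n \<Longrightarrow> h j \<le> h i"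
    and part: "\<And>k. k \<le> n \<Longrightarrow> (\<Sum>i<k. d i) \<ge> 0" and total: "(\<Sum>i<n. d i) = 0"
  shows "(\<Sum>i<n. h i * d i) \<ge> 0"
proof (cases n)
  case (Suc m)
  \<comment> \<open>Abel summation as an induction: replacing \<open>h k\<close> by the smaller
    \<open>h (Suc k)\<close> can only decrease its product with a nonnegative partial sum. At the
    last index the total is zero.\<close>
  have "h k * (\<Sum>i<Suc k. d i) \<le> (\<Sum>i<Suc k. h i * d i)" if "k < n" for k
    using that
  proof (induction k)
    case (Suc k)
    have "h (Suc k) * (\<Sum>i<Suc k. d i) \<le> h k * (\<Sum>i<Suc k. d i)"
      using Suc.prems by (intro mult_right_mono anti part) auto
    also have "\<dots> \<le> (\<Sum>i<Suc k. h i * d i)" using Suc by simp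
    finally show ?case by (simp add: distrib_left)
  qed simp
  from this[of m] have "h m * (\<Sum>i<n. d i) \<le> (\<Sum>i<n. h i * d i)" unfolding Suc by blast
  then show ?thesis unfolding total by simp
qed simp

text \<open>Karamata's inequality under log-majorization. Stating the bound for every index set
  \<open>I\<close> allows \<open>w\<close> to be unsorted, as it is when eigenvalues of
  \<open>A\<close> and \<open>B\<close> are paired in opposite orders; \<open>z\<close> enters only
  through initial products.\<close>

lemma sum_le_of_prod_le:
  fixes f f' :: "real \<Rightarrow> real" and w z :: "nat \<Rightarrow> real"
  assumes deriv: "\<And>s. 0 < s \<Longrightarrow> (f has_real_derivative f' s) (at s)"
    and mono: "mono_on {0<..} (\<lambda>s. s * f' s)"
    and w: "\<And>i. i < n \<Longrightarrow> w i > 0" and z: "\<And>i. i < n \<Longrightarrow> z i > 0"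
    and le: "\<And>I. I \<subseteq> {..<n} \<Longrightarrow> (\<Prod>i\<in>I. w i) \<le> (\<Prod>i<card I. z i)"
    and eq: "(\<Prod>i<n. w i) = (\<Prod>i<n. z i)"
  shows "(\<Sum>i<n. f (w i)) \<le> (\<Sum>i<n. f (z i))"
proof -
  \<comment> \<open>Sorting by the negated key lists the values of \<open>w\<close> in decreasing
    order. An initial segment of this order is one of the sets \<open>I\<close>.\<close>
  define l where "l = sort_key (\<lambda>i. - w i) [0..<n]"
  define \<sigma> where "\<sigma> i = l ! i" for i
  have l: "length l = n" "distinct l" "set l = {..<n}" unfolding l_def by auto
  have bij: "bij_betw \<sigma> {..<n} {..<n}"
    unfolding \<sigma>_def using bij_betw_nth[OF l(2)] l by auto
  have \<sigma>_lt: "\<sigma> i < n" if "i < n" for i using bij that by (auto simp: bij_betw_def)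
  define u where "u i = w (\<sigma> i)" for i
  have u: "u i > 0" if "i < n" for i unfolding u_def using w \<sigma>_lt that by simp
  have u_anti: "u j \<le> u i" if "i \<le> j" "j < n" for i j
  proof -
    have "sorted (map (\<lambda>i. - w i) l)" unfolding l_def by simp
    from sorted_nth_mono[OF this that(1)] show ?thesis
      using that l unfolding u_def \<sigma>_def by simp
  qed
  have inj: "inj_on \<sigma> {..<k}" if "k \<le> n" for k
    using bij that inj_on_subset[of \<sigma> "{..<n}" "{..<k}"] by (auto simp: bij_betw_def)
  have prod_le: "(\<Prod>i<k. u i) \<le> (\<Prod>i<k. z i)" if k: "k \<le> n" for k
  proof -
    have "(\<Prod>i<k. u i) = (\<Prod>i\<in>\<sigma> ` {..<k}. w i)"
      unfolding u_def by (simp add: prod.reindex[OF inj[OF k]])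
    also have "\<dots> \<le> (\<Prod>i<card (\<sigma> ` {..<k}). z i)"
      using \<sigma>_lt k by (intro le) auto
    finally show ?thesis by (simp add: card_image[OF inj[OF k]])
  qed
  have prod_eq: "(\<Prod>i<n. u i) = (\<Prod>i<n. z i)"
    unfolding u_def eq[symmetric] by (rule prod.reindex_bij_betw[OF bij])
  have ln_sum: "(\<Sum>i<k. ln (z i) - ln (u i)) = ln (\<Prod>i<k. z i) - ln (\<Prod>i<k. u i)" if "k \<le> n" for k
  proof -
    have "u i \<noteq> 0" "z i \<noteq> 0" if "i < k" for i
      using u[of i] z[of i] that \<open>k \<le> n\<close> by auto
    then show ?thesis by (subst (1 2) ln_prod) (auto simp: sum_subtractf)
  qed
  \<comment> \<open>The tangent slopes \<open>u i * f' (u i)\<close> decrease along with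
    \<open>u\<close>, and the log differences have nonnegative partial sums and zero total, so Abel
    summation applies.\<close>
  have "0 \<le> (\<Sum>i<n. u i * f' (u i) * (ln (z i) - ln (u i)))"
  proof (rule sum_mult_antitone_nonneg)
    fix i j assume "i \<le> j" "j < n"
    then show "u j * f' (u j) \<le> u i * f' (u i)"
      using mono_onD[OF mono, of "u j" "u i"] u u_anti by simp
  next
    fix k assume k: "k \<le> n"
    have "(\<Prod>i<k. u i) > 0" by (intro prod_pos) (use u k in auto)
    then show "0 \<le> (\<Sum>i<k. ln (z i) - ln (u i))"
      unfolding ln_sum[OF k] using prod_le[OF k] by simp
  next
    show "(\<Sum>i<n. ln (z i) - ln (u i)) = 0" using ln_sum[of n] prod_eq by simp
  qed
  also have "\<dots> \<le> (\<Sum>i<n. f (z i) - f (u i))"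
    by (intro sum_mono log_tangent_ineq[OF deriv mono]) (use u z in auto)
  also have "\<dots> = (\<Sum>i<n. f (z i)) - (\<Sum>i<n. f (w i))"
    unfolding u_def sum_subtractf by (simp add: sum.reindex_bij_betw[OF bij, of "\<lambda>i. f (w i)"])
  finally show ?thesis by simp
qed

lemma prod_antitone_le:
  fixes b :: "nat \<Rightarrow> real"
  assumes I: "I \<subseteq> {..<n}" and anti: "\<And>i j. i \<le> j \<Longrightarrow> j < n \<Longrightarrow> b j \<le> b i"
    and pos: "\<And>i. i < n \<Longrightarrow> b i \<ge> 0"
  shows "(\<Prod>i\<in>I. b i) \<le> (\<Prod>i<card I. b i)"
proof -
  have "finite I" using I finite_subset by blast
  then show ?thesis using I
  proof (induction I rule: finite_linorder_max_induct)
    case (insert m A)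
    then have m: "m < n" "A \<subseteq> {..<m}" "m \<notin> A" by auto
    \<comment> \<open>The induction adds the largest element \<open>m\<close>. All of
      \<open>A\<close> lies below it, so \<open>m\<close> is no earlier than the next free position
      \<open>card A\<close>.\<close>
    have "card A \<le> m" using card_mono[OF _ m(2)] by simp
    then have "b m \<le> b (card A)" using m by (intro anti)
    then have "b m * (\<Prod>i\<in>A. b i) \<le> b (card A) * (\<Prod>i<card A. b i)"
      using insert m \<open>card A \<le> m\<close> by (intro mult_mono pos prod_nonneg) auto
    then show ?case using insert m by (simp add: mult.commute)
  qed simp
qed

section \<open>The inequalities for eigenvalue sums\<close>

text \<open>The Lidskii bound with \<open>S = C\<close> has \<open>S * S = B\<close>; the product
  for \<open>B\<close> over \<open>I\<close> is then at most the one over the initial segment of the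
  same size.\<close>

lemma prod_eigval_upper:
  assumes A: "A \<in> carrier_mat n n" "pos_def A" and B: "B \<in> carrier_mat n n" "pos_def B"
    and I: "I \<subseteq> {..<n}"
  shows "(\<Prod>i\<in>I. eigval (Suc i) (psd_sqrt B * A * psd_sqrt B)) \<le>
    (\<Prod>i<card I. eigval (Suc i) A * eigval (Suc i) B)"
proof -
  define C where "C = psd_sqrt B"
  have C: "C \<in> carrier_mat n n" "pos_semidef C" "C * C = B"
    unfolding C_def using psd_sqrt_props[OF B(1) pos_def_imp_semidef[OF B]] by auto
  have sym: "transpose_mat C = C" "transpose_mat B = B"
    using C B unfolding pos_semidef_def pos_def_def by auto
  have "det C * det C = det B" using det_mult[OF C(1) C(1)] C(3) by simp
  then have detC: "det C \<noteq> 0" using pos_def_det_pos[OF B] by auto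
  have cardI: "card I \<le> n" using card_mono[OF _ I] by simp
  have "(\<Prod>i\<in>I. eigval (Suc i) (C * A * C)) \<le>
    (\<Prod>i\<in>I. eigval (Suc i) B) * (\<Prod>i<card I. eigval (Suc i) A)"
    using prod_eigval_congruence_le[OF A C(1) detC I] by (simp add: sym C(3))
  also have "\<dots> \<le> (\<Prod>i<card I. eigval (Suc i) B) * (\<Prod>i<card I. eigval (Suc i) A)"
  proof (rule mult_right_mono)
    show "(\<Prod>i\<in>I. eigval (Suc i) B) \<le> (\<Prod>i<card I. eigval (Suc i) B)"
      using eigval_pos[OF B] eigval_antimono[OF B(1) sym(2)]
      by (intro prod_antitone_le[OF I]) (auto simp: less_imp_le)
    show "(\<Prod>i<card I. eigval (Suc i) A) \<ge> 0"
      using eigval_pos[OF A] cardI by (intro prod_nonneg) (auto simp: less_imp_le)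
  qed
  finally show ?thesis unfolding C_def by (simp add: prod.distrib mult.commute)
qed

text \<open>Undoing the congruence by the inverse root \<open>S\<close> recovers \<open>A\<close>
  from \<open>C * A * C\<close>. The Lidskii bound then carries the eigenvalues of the inverse of
  \<open>B\<close>, whose reciprocals move to the left-hand side.\<close>

lemma prod_eigval_lower:
  assumes A: "A \<in> carrier_mat n n" "pos_def A" and B: "B \<in> carrier_mat n n" "pos_def B"
    and I: "I \<subseteq> {..<n}"
  shows "(\<Prod>i\<in>I. eigval (Suc i) A * eigval (n - i) B) \<le>
    (\<Prod>i<card I. eigval (Suc i) (psd_sqrt B * A * psd_sqrt B))"
proof -
  let ?b = "\<lambda>i. eigval (Suc i) B"
  define C where "C = psd_sqrt B"
  obtain U where U: "U \<in> carrier_mat n n" "transpose_mat U * U = 1\<^sub>m n"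
    and B_eq: "B = U * mat_diag n ?b * transpose_mat U"
    and C_eq: "C = U * mat_diag n (\<lambda>i. sqrt (?b i)) * transpose_mat U"
    unfolding C_def using psd_sqrt_diagonalize[OF B(1) pos_def_imp_semidef[OF B]] by blast
  have Ut: "transpose_mat U \<in> carrier_mat n n" using U by simp
  have UU: "U * transpose_mat U = 1\<^sub>m n" by (rule mat_mult_left_right_inverse[OF Ut U])
  have b_pos: "?b i > 0" if "i < n" for i using eigval_pos[OF B that] .
  have symB: "transpose_mat B = B" using B unfolding pos_def_def by simp
  define S where "S = U * mat_diag n (\<lambda>i. 1 / sqrt (?b i)) * transpose_mat U"
  have C: "C \<in> carrier_mat n n" "transpose_mat C = C"
    unfolding C_eq by (rule orth_diag_carrier[OF U(1)], rule transpose_orth_diag[OF U(1)])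
  have S: "S \<in> carrier_mat n n" "transpose_mat S = S"
    unfolding S_def by (rule orth_diag_carrier[OF U(1)], rule transpose_orth_diag[OF U(1)])
  have diag_one: "mat_diag n (\<lambda>i. 1 / sqrt (?b i) * sqrt (?b i)) = 1\<^sub>m n"
    using b_pos by (intro eq_matI) (auto simp: mat_diag_def less_imp_neq[symmetric])
  have SC: "S * C = 1\<^sub>m n"
    unfolding S_def C_eq orth_diag_mult[OF U] diag_one using U UU by simp
  then have CS: "C * S = 1\<^sub>m n" using mat_mult_left_right_inverse[OF S(1) C(1)] by simp
  have "det S * det C = 1" using det_mult[OF S(1) C(1)] SC by simp
  then have detS: "det S \<noteq> 0" and detC: "det C \<noteq> 0" by auto
  have "mat_diag n (\<lambda>i. 1 / sqrt (?b i) * (1 / sqrt (?b i))) = mat_diag n (\<lambda>i. 1 / ?b i)"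
    using b_pos by (intro eq_matI) (auto simp: mat_diag_def less_imp_le)
  then have SS: "S * S = U * mat_diag n (\<lambda>i. 1 / ?b i) * transpose_mat U"
    unfolding S_def orth_diag_mult[OF U] by simp
  \<comment> \<open>Reciprocals reverse the order: position \<open>i\<close> from 0 in
    \<open>S * S\<close> comes from position \<open>n - Suc i\<close> in \<open>B\<close>, which is
    \<open>n - i\<close> in the 1-based numbering of \<open>eigval\<close>.\<close>
  have ev_SS: "eigval (Suc i) (S * S) = 1 / eigval (n - i) B" if "i < n" for i
  proof -
    have "eigval (Suc i) (S * S) = 1 / ?b (n - Suc i)"
      unfolding SS
    proof (rule eigval_orth_diag_rev[OF U _ that])
      fix i j assume "i \<le> j" "j < n"
      then show "1 / ?b i \<le> 1 / ?b j"
        using b_pos[of j] eigval_antimono[OF B(1) symB] by (intro divide_left_mono mult_pos_pos b_pos) auto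
    qed
    then show ?thesis using that by (simp add: Suc_diff_Suc)
  qed
  have CAC: "C * A * C \<in> carrier_mat n n" "pos_def (C * A * C)"
    using C A pos_def_congruence[OF C(1) detC A] by auto
  have "S * (C * A * C) * S = (S * C) * A * (C * S)"
    using S C A by (simp add: assoc_mult_mat[of _ n n _ n _ n])
  then have A_eq: "S * (C * A * C) * S = A" using A by (simp add: SC CS)
  have "(\<Prod>i\<in>I. eigval (Suc i) A) \<le>
    (\<Prod>i\<in>I. eigval (Suc i) (S * S)) * (\<Prod>i<card I. eigval (Suc i) (C * A * C))"
    using prod_eigval_congruence_le[OF CAC S(1) detS I] by (simp add: S(2) A_eq)
  also have "(\<Prod>i\<in>I. eigval (Suc i) (S * S)) = (\<Prod>i\<in>I. 1 / eigval (n - i) B)"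
    using ev_SS I by (intro prod.cong) auto
  also have "\<dots> = 1 / (\<Prod>i\<in>I. eigval (n - i) B)" by (simp add: prod_dividef)
  finally have "(\<Prod>i\<in>I. eigval (Suc i) A) \<le>
    1 / (\<Prod>i\<in>I. eigval (n - i) B) * (\<Prod>i<card I. eigval (Suc i) (C * A * C))" .
  moreover have "(\<Prod>i\<in>I. eigval (n - i) B) > 0"
  proof (rule prod_pos)
    fix i assume "i \<in> I"
    then have "i < n" using I by auto
    then show "eigval (n - i) B > 0" using b_pos[of "n - Suc i"] by (simp add: Suc_diff_Suc)
  qed
  ultimately show ?thesis unfolding C_def by (simp add: field_simps prod.distrib)
qed

text \<open>Supplies the equality of full products and the positivity that Karamata's inequality
  requires; the equality is multiplicativity of the determinant.\<close>

lemma prod_eigval_sqrt_congruence: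
  assumes A: "A \<in> carrier_mat n n" "pos_def A" and B: "B \<in> carrier_mat n n" "pos_def B"
  shows "(\<Prod>i<n. eigval (Suc i) (psd_sqrt B * A * psd_sqrt B)) =
    (\<Prod>i<n. eigval (Suc i) A) * (\<Prod>i<n. eigval (Suc i) B)"
    and "i < n \<Longrightarrow> eigval (Suc i) (psd_sqrt B * A * psd_sqrt B) > 0"
proof -
  define C where "C = psd_sqrt B"
  have C: "C \<in> carrier_mat n n" "pos_semidef C" "C * C = B"
    unfolding C_def using psd_sqrt_props[OF B(1) pos_def_imp_semidef[OF B]] by auto
  have sym: "transpose_mat C = C" "transpose_mat A = A" "transpose_mat B = B"
    using C A B unfolding pos_semidef_def pos_def_def by auto
  have detB: "det C * det C = det B" using det_mult[OF C(1) C(1)] C(3) by simp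
  then have detC: "det C \<noteq> 0" using pos_def_det_pos[OF B] by auto
  have CAC: "C * A * C \<in> carrier_mat n n" "transpose_mat (C * A * C) = C * A * C" "pos_def (C * A * C)"
    using C(1) A transpose_congruence[OF C(1) A(1) sym(2)] pos_def_congruence[OF C(1) detC A]
    by (auto simp: sym(1))
  have "det (C * A * C) = det A * (det C * det C)"
    using C A by (simp add: det_mult[of _ n])
  then show "(\<Prod>i<n. eigval (Suc i) (psd_sqrt B * A * psd_sqrt B)) =
    (\<Prod>i<n. eigval (Suc i) A) * (\<Prod>i<n. eigval (Suc i) B)"
    unfolding detB det_eq_prod_eigval[OF CAC(1,2)] det_eq_prod_eigval[OF A(1) sym(2)]
      det_eq_prod_eigval[OF B(1) sym(3)] by (simp add: C_def)
  show "i < n \<Longrightarrow> eigval (Suc i) (psd_sqrt B * A * psd_sqrt B) > 0"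
    using eigval_pos[OF CAC(1,3)] by (simp add: C_def)
qed

lemma sum_eigval_pos_def:
  fixes f f' :: "real \<Rightarrow> real"
  assumes deriv: "\<And>s. 0 < s \<Longrightarrow> (f has_real_derivative f' s) (at s)"
    and mono: "mono_on {0<..} (\<lambda>s. s * f' s)"
    and A: "A \<in> carrier_mat n n" "pos_def A" and B: "B \<in> carrier_mat n n" "pos_def B"
  shows "(\<Sum>i<n. f (eigval (Suc i) A * eigval (n - i) B)) \<le>
      (\<Sum>i<n. f (eigval (Suc i) (psd_sqrt B * A * psd_sqrt B)))"
    and "(\<Sum>i<n. f (eigval (Suc i) (psd_sqrt B * A * psd_sqrt B))) \<le>
      (\<Sum>i<n. f (eigval (Suc i) A * eigval (Suc i) B))"
proof -
  have rev_pos: "eigval (n - i) B > 0" if "i < n" for i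
    using eigval_pos[OF B, of "n - Suc i"] that by (simp add: Suc_diff_Suc)
  have "(\<Prod>i<n. eigval (n - i) B) = (\<Prod>i<n. eigval (Suc (n - Suc i)) B)"
    by (rule prod.cong) (auto simp: Suc_diff_Suc)
  also have "\<dots> = (\<Prod>i<n. eigval (Suc i) B)"
    by (rule prod.nat_diff_reindex)
  finally have rev: "(\<Prod>i<n. eigval (n - i) B) = (\<Prod>i<n. eigval (Suc i) B)" .
  show "(\<Sum>i<n. f (eigval (Suc i) A * eigval (n - i) B)) \<le>
      (\<Sum>i<n. f (eigval (Suc i) (psd_sqrt B * A * psd_sqrt B)))"
    using eigval_pos[OF A] rev_pos prod_eigval_sqrt_congruence[OF A B] prod_eigval_lower[OF A B]
    by (intro sum_le_of_prod_le[OF deriv mono]) (auto simp: prod.distrib rev)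
  show "(\<Sum>i<n. f (eigval (Suc i) (psd_sqrt B * A * psd_sqrt B))) \<le>
      (\<Sum>i<n. f (eigval (Suc i) A * eigval (Suc i) B))"
    using eigval_pos[OF A] eigval_pos[OF B] prod_eigval_sqrt_congruence[OF A B] prod_eigval_upper[OF A B]
    by (intro sum_le_of_prod_le[OF deriv mono]) (auto simp: prod.distrib)
qed

section \<open>Passage to the semidefinite case\<close>

lemma tendsto_compose_nonneg:
  fixes f :: "real \<Rightarrow> real"
  assumes cont: "\<And>s. 0 < s \<Longrightarrow> isCont f s" and cont0: "continuous (at_right 0) f"
    and g: "(g \<longlongrightarrow> L) F" "eventually (\<lambda>e. g e > 0) F" and L: "L \<ge> 0"
  shows "((\<lambda>e. f (g e)) \<longlongrightarrow> f L) F"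
proof (cases "L = 0")
  case True
  \<comment> \<open>Eventual positivity of \<open>g\<close> makes a limit 0 an approach from the
    right, where the one-sided continuity of \<open>f\<close> suffices.\<close>
  have "filterlim g (at_right 0) F"
    using g True by (intro tendsto_imp_filterlim_at_right) auto
  moreover have "(f \<longlongrightarrow> f 0) (at_right 0)" using cont0 by (simp add: continuous_within)
  ultimately show ?thesis using True filterlim_compose by blast
next
  case False
  then show ?thesis using isCont_tendsto_compose[OF cont g(1)] L by simp
qed

lemma transpose_add_smult_one:
  fixes A :: "real mat"
  assumes A: "A \<in> carrier_mat n n" "transpose_mat A = A"
  shows "transpose_mat (A + e \<cdot>\<^sub>m 1\<^sub>m n) = A + e \<cdot>\<^sub>m 1\<^sub>m n"
proof (rule eq_matI)
  fix i j assume "i < dim_row (A + e \<cdot>\<^sub>m 1\<^sub>m n)" "j < dim_col (A + e \<cdot>\<^sub>m 1\<^sub>m n)"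
  then have ij: "i < n" "j < n" by auto
  have "A $$ (j, i) = A $$ (i, j)" using A ij by (metis carrier_matD index_transpose_mat(1))
  then show "transpose_mat (A + e \<cdot>\<^sub>m 1\<^sub>m n) $$ (i, j) = (A + e \<cdot>\<^sub>m 1\<^sub>m n) $$ (i, j)"
    using A(1) ij by auto
qed (use A(1) in auto)

lemma pos_def_add_smult_one:
  fixes A :: "real mat"
  assumes A: "A \<in> carrier_mat n n" "pos_semidef A" and e: "e > 0"
  shows "pos_def (A + e \<cdot>\<^sub>m 1\<^sub>m n)"
proof -
  have "transpose_mat (A + e \<cdot>\<^sub>m 1\<^sub>m n) = A + e \<cdot>\<^sub>m 1\<^sub>m n"
    using A(2) by (intro transpose_add_smult_one[OF A(1)]) (simp add: pos_semidef_def)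
  moreover have "v \<bullet> ((A + e \<cdot>\<^sub>m 1\<^sub>m n) *\<^sub>v v) > 0" if v: "v \<in> carrier_vec n" "v \<noteq> 0\<^sub>v n" for v
  proof -
    have "(A + e \<cdot>\<^sub>m 1\<^sub>m n) *\<^sub>v v = A *\<^sub>v v + e \<cdot>\<^sub>v v"
      using A(1) v(1) by (intro eq_vecI) (auto simp: add_scalar_prod_distrib[of _ n])
    then have "v \<bullet> ((A + e \<cdot>\<^sub>m 1\<^sub>m n) *\<^sub>v v) = v \<bullet> (A *\<^sub>v v) + e * (v \<bullet> v)"
      using A v by (simp add: scalar_prod_add_distrib[of _ n])
    then show ?thesis
      using A v e scalar_prod_self_pos[OF v] unfolding pos_semidef_def
      by (simp add: add_nonneg_pos)
  qed
  ultimately show ?thesis using A unfolding pos_def_def by simp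
qed

lemma tendsto_mult_mat:
  fixes X Y :: "'a \<Rightarrow> real mat"
  assumes dims: "\<And>e. X e \<in> carrier_mat n n" "\<And>e. Y e \<in> carrier_mat n n"
    "X0 \<in> carrier_mat n n" "Y0 \<in> carrier_mat n n"
    and X: "\<And>i j. i < n \<Longrightarrow> j < n \<Longrightarrow> ((\<lambda>e. X e $$ (i, j)) \<longlongrightarrow> X0 $$ (i, j)) F"
    and Y: "\<And>i j. i < n \<Longrightarrow> j < n \<Longrightarrow> ((\<lambda>e. Y e $$ (i, j)) \<longlongrightarrow> Y0 $$ (i, j)) F"
    and ij: "i < n" "j < n"
  shows "((\<lambda>e. (X e * Y e) $$ (i, j)) \<longlongrightarrow> (X0 * Y0) $$ (i, j)) F"
proof -
  have entry: "(P * Q) $$ (i, j) = (\<Sum>k<n. P $$ (i, k) * Q $$ (k, j))"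
    if "P \<in> carrier_mat n n" "Q \<in> carrier_mat n n" for P Q :: "real mat"
    using that ij by (simp add: scalar_prod_def atLeast0LessThan)
  show ?thesis
    unfolding entry[OF dims(1,2)] entry[OF dims(3,4)]
    by (intro tendsto_sum tendsto_mult X Y) (use ij in auto)
qed

lemma sum_eigval_pos_semidef:
  fixes f f' :: "real \<Rightarrow> real"
  assumes deriv: "\<And>s. 0 < s \<Longrightarrow> (f has_real_derivative f' s) (at s)"
    and mono: "mono_on {0<..} (\<lambda>s. s * f' s)" and cont0: "continuous (at_right 0) f"
    and A: "A \<in> carrier_mat n n" "pos_semidef A" and B: "B \<in> carrier_mat n n" "pos_semidef B"
  shows "(\<Sum>i<n. f (eigval (Suc i) A * eigval (n - i) B)) \<le>
      (\<Sum>i<n. f (eigval (Suc i) (psd_sqrt B * A * psd_sqrt B)))" (is ?lower)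
    and "(\<Sum>i<n. f (eigval (Suc i) (psd_sqrt B * A * psd_sqrt B))) \<le>
      (\<Sum>i<n. f (eigval (Suc i) A * eigval (Suc i) B))" (is ?upper)
proof -
  define C where "C = psd_sqrt B"
  have C: "C \<in> carrier_mat n n" "pos_semidef C" "C * C = B"
    unfolding C_def using psd_sqrt_props[OF B] by auto
  have sym: "transpose_mat A = A" "transpose_mat B = B" "transpose_mat C = C"
    using A B C unfolding pos_semidef_def by auto
  let ?F = "at_right (0 :: real)"
  define A' where "A' e = A + e \<cdot>\<^sub>m 1\<^sub>m n" for e
  define C' where "C' e = C + e \<cdot>\<^sub>m 1\<^sub>m n" for e
  \<comment> \<open>Perturbing the root instead of \<open>B\<close> makes the root of
    \<open>B' e\<close> explicit, namely \<open>C' e\<close>, so the argument avoids continuity of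
    the square root.\<close>
  define B' where "B' e = C' e * C' e" for e
  define X' where "X' e = C' e * A' e * C' e" for e
  define X where "X = C * A * C"
  have A': "A' e \<in> carrier_mat n n" "transpose_mat (A' e) = A' e" for e
    unfolding A'_def using A(1) transpose_add_smult_one[OF A(1) sym(1)] by auto
  have C': "C' e \<in> carrier_mat n n" "transpose_mat (C' e) = C' e" for e
    unfolding C'_def using C(1) transpose_add_smult_one[OF C(1) sym(3)] by auto
  have B': "B' e \<in> carrier_mat n n" "transpose_mat (B' e) = B' e" for e
    unfolding B'_def using C'[of e] by (auto simp: transpose_mult[of _ n n _ n])
  have X': "X' e \<in> carrier_mat n n" "transpose_mat (X' e) = X' e" for e
    unfolding X'_def using C'[of e] A'[of e] transpose_congruence[OF C'(1) A'(1,2), of e e] by auto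
  have X: "X \<in> carrier_mat n n" "transpose_mat X = X"
    unfolding X_def using C A sym transpose_congruence[OF C(1) A(1) sym(1)] by auto
  have A'_pd: "pos_def (A' e)" if "e > 0" for e
    unfolding A'_def by (rule pos_def_add_smult_one[OF A that])
  have C'_pd: "pos_def (C' e)" if "e > 0" for e
    unfolding C'_def by (rule pos_def_add_smult_one[OF C(1,2) that])
  have B'_pd: "pos_def (B' e)" if "e > 0" for e
    using pos_def_congruence[OF C'(1) _ one_carrier_mat pos_def_one, of e]
      pos_def_det_pos[OF C'(1) C'_pd[OF that]] C'[of e] unfolding B'_def by simp
  have sqrt_B': "psd_sqrt (B' e) = C' e" if "e > 0" for e
    unfolding B'_def by (rule psd_sqrt_eqI[OF C'(1) pos_def_imp_semidef[OF C'(1) C'_pd[OF that]]])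
  have shift: "((\<lambda>e. (Y + e \<cdot>\<^sub>m 1\<^sub>m n) $$ (i, j)) \<longlongrightarrow> Y $$ (i, j)) ?F"
    if "Y \<in> carrier_mat n n" "i < n" "j < n" for Y i j
  proof -
    have "((\<lambda>e. Y $$ (i, j) + e * 1\<^sub>m n $$ (i, j)) \<longlongrightarrow> Y $$ (i, j) + 0 * 1\<^sub>m n $$ (i, j)) ?F"
      by (intro tendsto_intros)
    then show ?thesis using that by simp
  qed
  have lim_A': "((\<lambda>e. A' e $$ (i, j)) \<longlongrightarrow> A $$ (i, j)) ?F" if "i < n" "j < n" for i j
    unfolding A'_def using shift[OF A(1) that] .
  have lim_C': "((\<lambda>e. C' e $$ (i, j)) \<longlongrightarrow> C $$ (i, j)) ?F" if "i < n" "j < n" for i j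
    unfolding C'_def using shift[OF C(1) that] .
  have lim_B': "((\<lambda>e. B' e $$ (i, j)) \<longlongrightarrow> B $$ (i, j)) ?F" if "i < n" "j < n" for i j
    unfolding B'_def C(3)[symmetric]
    by (rule tendsto_mult_mat[OF C'(1) C'(1) C(1) C(1) lim_C' lim_C' that])
  have CA': "C' e * A' e \<in> carrier_mat n n" for e using C'(1) A'(1) by (rule mult_carrier_mat)
  have CA: "C * A \<in> carrier_mat n n" using C(1) A(1) by (rule mult_carrier_mat)
  have lim_CA': "((\<lambda>e. (C' e * A' e) $$ (i, j)) \<longlongrightarrow> (C * A) $$ (i, j)) ?F"
    if "i < n" "j < n" for i j
    by (rule tendsto_mult_mat[OF C'(1) A'(1) C(1) A(1) lim_C' lim_A' that])
  have lim_X': "((\<lambda>e. X' e $$ (i, j)) \<longlongrightarrow> X $$ (i, j)) ?F" if "i < n" "j < n" for i j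
    unfolding X'_def X_def by (rule tendsto_mult_mat[OF CA' C'(1) CA C(1) lim_CA' lim_C' that])
  have ev_A: "((\<lambda>e. eigval (Suc i) (A' e)) \<longlongrightarrow> eigval (Suc i) A) ?F" if "i < n" for i
    by (rule tendsto_eigval[OF A' A(1) sym(1) that lim_A'])
  have ev_B: "((\<lambda>e. eigval (Suc i) (B' e)) \<longlongrightarrow> eigval (Suc i) B) ?F" if "i < n" for i
    by (rule tendsto_eigval[OF B' B(1) sym(2) that lim_B'])
  have ev_X: "((\<lambda>e. eigval (Suc i) (X' e)) \<longlongrightarrow> eigval (Suc i) X) ?F" if "i < n" for i
    by (rule tendsto_eigval[OF X' X that lim_X'])
  have ev_pos: "eventually (\<lambda>e. eigval (Suc i) (A' e) > 0 \<and> eigval (Suc i) (B' e) > 0 \<and> eigval (Suc i) (X' e) > 0) ?F"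
    if "i < n" for i
    using eventually_at_right_less[of 0]
  proof eventually_elim
    case (elim e)
    then show ?case
      using eigval_pos[OF A'(1) A'_pd that] eigval_pos[OF B'(1) B'_pd that]
        prod_eigval_sqrt_congruence(2)[OF A'(1) A'_pd B'(1) B'_pd that] sqrt_B'
      by (simp add: X'_def)
  qed
  \<comment> \<open>Makes the limiting eigenvalues of \<open>X\<close> nonnegative, as required for
    passing \<open>f\<close> to the limit.\<close>
  have X_psd: "pos_semidef X"
    unfolding pos_semidef_def
  proof (intro conjI ballI)
    fix v :: "real vec" assume "v \<in> carrier_vec (dim_row X)"
    then have v: "v \<in> carrier_vec n" using X by simp
    have "v \<bullet> (X *\<^sub>v v) = (C *\<^sub>v v) \<bullet> (A *\<^sub>v (C *\<^sub>v v))"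
      using quad_form_congruence[OF C(1) A(1) v] by (simp add: sym(3) X_def)
    then show "0 \<le> v \<bullet> (X *\<^sub>v v)" using A C(1) v unfolding pos_semidef_def by simp
  qed (rule X(2))
  note isCont = DERIV_isCont[OF deriv]
  note compose = tendsto_compose_nonneg[OF isCont cont0]
  have lim_f_prod: "((\<lambda>e. f (eigval (Suc i) (A' e) * eigval (Suc j) (B' e))) \<longlongrightarrow>
      f (eigval (Suc i) A * eigval (Suc j) B)) ?F" if "i < n" "j < n" for i j
  proof (rule compose)
    show "\<forall>\<^sub>F e in ?F. 0 < eigval (Suc i) (A' e) * eigval (Suc j) (B' e)"
      using ev_pos[OF that(1)] ev_pos[OF that(2)] by eventually_elim simp
  qed (use that eigval_nonneg[OF A] eigval_nonneg[OF B] in \<open>auto intro!: tendsto_mult ev_A ev_B\<close>)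
  have lim_f_X: "((\<lambda>e. f (eigval (Suc i) (X' e))) \<longlongrightarrow> f (eigval (Suc i) X)) ?F" if "i < n" for i
  proof (rule compose)
    show "\<forall>\<^sub>F e in ?F. 0 < eigval (Suc i) (X' e)" using ev_pos[OF that] by eventually_elim simp
  qed (use that eigval_nonneg[OF X(1) X_psd] in \<open>auto intro!: ev_X\<close>)
  have lim_lower: "((\<lambda>e. \<Sum>i<n. f (eigval (Suc i) (A' e) * eigval (n - i) (B' e))) \<longlongrightarrow>
      (\<Sum>i<n. f (eigval (Suc i) A * eigval (n - i) B))) ?F"
  proof (rule tendsto_sum)
    fix i assume "i \<in> {..<n}"
    then have "i < n" "n - Suc i < n" "Suc (n - Suc i) = n - i" by auto
    then show "((\<lambda>e. f (eigval (Suc i) (A' e) * eigval (n - i) (B' e))) \<longlongrightarrow>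
      f (eigval (Suc i) A * eigval (n - i) B)) ?F" using lim_f_prod by metis
  qed
  have lim_upper: "((\<lambda>e. \<Sum>i<n. f (eigval (Suc i) (A' e) * eigval (Suc i) (B' e))) \<longlongrightarrow>
      (\<Sum>i<n. f (eigval (Suc i) A * eigval (Suc i) B))) ?F"
    by (intro tendsto_sum lim_f_prod) auto
  have lim_mid: "((\<lambda>e. \<Sum>i<n. f (eigval (Suc i) (X' e))) \<longlongrightarrow> (\<Sum>i<n. f (eigval (Suc i) X))) ?F"
    by (intro tendsto_sum lim_f_X) auto
  have "(\<Sum>i<n. f (eigval (Suc i) A * eigval (n - i) B)) \<le> (\<Sum>i<n. f (eigval (Suc i) X))"
  proof (rule tendsto_le[OF _ lim_mid lim_lower])
    show "\<forall>\<^sub>F e in ?F. (\<Sum>i<n. f (eigval (Suc i) (A' e) * eigval (n - i) (B' e)))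
        \<le> (\<Sum>i<n. f (eigval (Suc i) (X' e)))"
      using eventually_at_right_less[of 0]
    proof eventually_elim
      case (elim e)
      then show ?case
        using sum_eigval_pos_def(1)[OF deriv mono A'(1) A'_pd B'(1) B'_pd, of e e] sqrt_B'
        by (simp add: X'_def)
    qed
  qed simp
  then show ?lower by (simp add: X_def C_def)
  have "(\<Sum>i<n. f (eigval (Suc i) X)) \<le> (\<Sum>i<n. f (eigval (Suc i) A * eigval (Suc i) B))"
  proof (rule tendsto_le[OF _ lim_upper lim_mid])
    show "\<forall>\<^sub>F e in ?F. (\<Sum>i<n. f (eigval (Suc i) (X' e)))
        \<le> (\<Sum>i<n. f (eigval (Suc i) (A' e) * eigval (Suc i) (B' e)))"
      using eventually_at_right_less[of 0]
    proof eventually_elim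
      case (elim e)
      then show ?case
        using sum_eigval_pos_def(2)[OF deriv mono A'(1) A'_pd B'(1) B'_pd, of e e] sqrt_B'
        by (simp add: X'_def)
    qed
  qed simp
  then show ?upper by (simp add: X_def C_def)
qed

theorem theorem3:
  fixes f f' :: "real \<Rightarrow> real"
  assumes "\<And>s. 0 < s \<Longrightarrow> (f has_real_derivative f' s) (at s)"
    and "mono_on {0<..} (\<lambda>s. s * f' s)"
  shows "(\<forall>n. \<forall>A \<in> carrier_mat n n. \<forall>B \<in> carrier_mat n n. pos_def A \<and> pos_def B \<longrightarrow>
            (\<Sum>i=1..n. f (eigval i A * eigval (n - i + 1) B))
              \<le> (\<Sum>i=1..n. f (eigval i (psd_sqrt B * A * psd_sqrt B))) \<and>
            (\<Sum>i=1..n. f (eigval i (psd_sqrt B * A * psd_sqrt B)))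
              \<le> (\<Sum>i=1..n. f (eigval i A * eigval i B))) \<and>
         (continuous (at_right 0) f \<longrightarrow>
          (\<forall>n. \<forall>A \<in> carrier_mat n n. \<forall>B \<in> carrier_mat n n. pos_semidef A \<and> pos_semidef B \<longrightarrow>
            (\<Sum>i=1..n. f (eigval i A * eigval (n - i + 1) B))
              \<le> (\<Sum>i=1..n. f (eigval i (psd_sqrt B * A * psd_sqrt B))) \<and>
            (\<Sum>i=1..n. f (eigval i (psd_sqrt B * A * psd_sqrt B)))
              \<le> (\<Sum>i=1..n. f (eigval i A * eigval i B))))"
proof -
  have shift: "(\<Sum>i=1..n. g i) = (\<Sum>i<n. g (Suc i))" for g :: "nat \<Rightarrow> real" and n
    by (simp add: sum.atLeast1_atMost_eq)
  \<comment> \<open>Natural subtraction is harmless here: for \<open>i < n\<close> the index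
    \<open>n - Suc i + 1\<close> equals \<open>n - i\<close>.\<close>
  have rev: "(\<Sum>i<n. f (eigval (Suc i) A * eigval (n - Suc i + 1) B))
      = (\<Sum>i<n. f (eigval (Suc i) A * eigval (n - i) B))" for n A B
    by (rule sum.cong) (auto simp: Suc_diff_Suc)
  show ?thesis
    unfolding shift rev
    using sum_eigval_pos_def[OF assms] sum_eigval_pos_semidef[OF assms] by blast
qed

end
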